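(* Let $\mathrm{Spec}(\mathcal{A}(D_n))$ be the set of continuous unital homomorphisms $\mathcal{A}(D_n)\to\mathbb{C}$ (for the pointwise product) with the weak-$*$ topology. Then $\delta:\hat D_n\to\mathrm{Spec}(\mathcal{A}(D_n))$, $[p,q]\mapsto\delta_{[p,q]}$, where $\delta_{[p,q]}(a)=\hat a([p,q])$, is a well-defined homeomorphism. Moreover, if $\mathrm{Spec}^*(\mathcal{A}(D_n))\subseteq\mathrm{Spec}(\mathcal{A}(D_n))$ denotes the subset of characters (continuous unital $*$-homomorphisms to $\mathbb{C}$) with the weak-$*$ topology, then $\delta$ restricts to a homeomorphism from $D_{n,\mathrm{ext}}$ onto $\mathrm{Spec}^*(\mathcal{A}(D_n))$.
   Context: Fix $n\ge1$. $D_n=Z/U(1)$ with $Z=\{r\in\mathbb{C}^{1+n}:-|r^0|^2+\sum_{i\ge1}|r^i|^2=-1\}$ and $U(1)$ acting by scalars. $\hat Z=\{(p,q)\in\mathbb{C}^{1+n}\times\mathbb{C}^{1+n}:-p^0q^0+\sum_{i\ge1}p^iq^i=-1\}$ with the free proper action $z\cdot(p,q)=(zp,q/z)$ of $\mathbb{C}^*$, and $\hat D_n=\hat Z/\mathbb{C}^*$, a complex manifold. $\Delta_D:D_n\to\hat D_n$, $[r]\mapsto[r,\bar r]$. $\tau:\hat D_n\to\hat D_n$, $\tau([p,q])=[\bar q,\bar p]$ (anti-holomorphic involution), and $D_{n,\mathrm{ext}}=\{x\in\hat D_n:\tau(x)=x\}$. $\mathcal{A}(D_n)=\{\hat a\circ\Delta_D:\hat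 a\in\mathcal{O}(\hat D_n)\}$, where for each $a$ the function $\hat a$ is unique; it is a commutative unital $*$-algebra under pointwise operations and pointwise complex conjugation $a^*=\bar a$ (so $\widehat{a^*}=\overline{\hat a\circ\tau}$), and a Fréchet space with seminorms $\|a\|_{D_n,K}=\sup_{x\in K}|\hat a(x)|$, $K\subseteq\hat D_n$ compact. *)

theory Defs
  imports "HOL-Analysis.Analysis"
begin

text \<open>Vectors in C^(1+n): index type 'n option, where None is the index 0
  and Some i (i :: 'n) are the indices 1..n, so n = CARD('n) \<ge> 1.\<close>

type_synonym 'n cvec = "complex ^ ('n option)"
type_synonym 'n cpair = "'n cvec \<times> 'n cvec"

definition vcnj :: "'n::finite cvec \<Rightarrow> 'n cvec" where
  "vcnj r = (\<chi> i. cnj (r $ i))"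

definition Zset :: "'n::finite cvec set" where
  "Zset = {r. - (cmod (r $ None))\<^sup>2 + (\<Sum>i\<in>UNIV. (cmod (r $ Some i))\<^sup>2) = -1}"

definition hatZ :: "'n::finite cpair set" where
  "hatZ = {(p, q). - (p $ None * q $ None) + (\<Sum>i\<in>UNIV. p $ Some i * q $ Some i) = -1}"

definition u1orb :: "'n::finite cvec \<Rightarrow> 'n cvec set" where
  "u1orb r = {z *s r | z. cmod z = 1}"

definition corb :: "'n::finite cvec \<Rightarrow> 'n cvec \<Rightarrow> 'n cpair set" where
  "corb p q = {(z *s p, inverse z *s q) | z. z \<noteq> 0}"

definition Dn :: "'n::finite cvec set set" where
  "Dn = u1orb ` Zset"

definition hatD :: "'n::finite cpair set set" where
  "hatD = (\<lambda>(p, q). corb p q) ` hatZ"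

text \<open>Delta_D [r] = [r, conj r]; independent of the representative r.\<close>
definition DeltaD :: "'n::finite cvec set \<Rightarrow> 'n cpair set" where
  "DeltaD x = (\<Union>r\<in>x. corb r (vcnj r))"

definition tau :: "'n::finite cpair set \<Rightarrow> 'n cpair set" where
  "tau x = {(vcnj q, vcnj p) | p q. (p, q) \<in> x}"

definition Dext :: "'n::finite cpair set set" where
  "Dext = {x \<in> hatD. tau x = x}"

definition hatD_top :: "'n::finite cpair set topology" where
  "hatD_top = topology (\<lambda>U. U \<subseteq> hatD \<and> openin (top_of_set hatZ) (\<Union>U))"

text \<open>Holomorphic functions on an open subset of C^(1+n) x C^(1+n) = C^(2n+2):
  real Frechet differentiable with complex-linear differential.\<close>
definition cscale :: "complex \<Rightarrow> 'n::finite cpair \<Rightarrow> 'n cpair" where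
  "cscale c w = (c *s fst w, c *s snd w)"

definition holo_open :: "'n::finite cpair set \<Rightarrow> ('n cpair \<Rightarrow> complex) \<Rightarrow> bool" where
  "holo_open U G \<longleftrightarrow> open U \<and>
     (\<forall>w\<in>U. \<exists>L. (G has_derivative L) (at w) \<and> (\<forall>v. L (cscale \<i> v) = \<i> * L v))"

definition holo_hatZ :: "('n::finite cpair \<Rightarrow> complex) \<Rightarrow> bool" where
  "holo_hatZ f \<longleftrightarrow> (\<forall>w\<in>hatZ. \<exists>U G. w \<in> U \<and> holo_open U G \<and> (\<forall>v\<in>U \<inter> hatZ. G v = f v))"

definition holo_hatD :: "('n::finite cpair set \<Rightarrow> complex) \<Rightarrow> bool" where
  "holo_hatD F \<longleftrightarrow> holo_hatZ (\<lambda>(p, q). F (corb p q))"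

definition AD :: "('n::finite cvec set \<Rightarrow> complex) set" where
  "AD = {(\<lambda>x. if x \<in> Dn then F (DeltaD x) else 0) | F. holo_hatD F}"

text \<open>The unique holomorphic extension hat a (normalised outside hatD).\<close>
definition hatA :: "('n::finite cvec set \<Rightarrow> complex) \<Rightarrow> 'n cpair set \<Rightarrow> complex" where
  "hatA a = (THE F. F \<in> extensional hatD \<and> holo_hatD F \<and> (\<forall>x\<in>Dn. a x = F (DeltaD x)))"

definition snorm :: "'n::finite cpair set set \<Rightarrow> ('n cvec set \<Rightarrow> complex) \<Rightarrow> real" where
  "snorm K a = Sup (insert 0 ((\<lambda>x. cmod (hatA a x)) ` K))"

text \<open>(sup over K, with value 0 for K empty)\<close>

definition AD_top :: "('n::finite cvec set \<Rightarrow> complex) topology" where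
  "AD_top = topology (\<lambda>U. U \<subseteq> AD \<and> (\<forall>a\<in>U. \<exists>Ks \<epsilon>. finite Ks \<and> (\<forall>K\<in>Ks. compactin hatD_top K) \<and>
      \<epsilon> > 0 \<and> {b \<in> AD. \<forall>K\<in>Ks. snorm K (\<lambda>x. b x - a x) < \<epsilon>} \<subseteq> U))"

definition unitA :: "'n::finite cvec set \<Rightarrow> complex" where
  "unitA = (\<lambda>x. if x \<in> Dn then 1 else 0)"

definition Spec :: "(('n::finite cvec set \<Rightarrow> complex) \<Rightarrow> complex) set" where
  "Spec = {\<phi>. \<phi> \<in> extensional AD \<and> continuous_map AD_top euclidean \<phi> \<and>
     (\<forall>a\<in>AD. \<forall>b\<in>AD. \<phi> (\<lambda>x. a x + b x) = \<phi> a + \<phi> b) \<and>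
     (\<forall>c. \<forall>a\<in>AD. \<phi> (\<lambda>x. c * a x) = c * \<phi> a) \<and>
     (\<forall>a\<in>AD. \<forall>b\<in>AD. \<phi> (\<lambda>x. a x * b x) = \<phi> a * \<phi> b) \<and>
     \<phi> unitA = 1}"

definition SpecStar :: "(('n::finite cvec set \<Rightarrow> complex) \<Rightarrow> complex) set" where
  "SpecStar = {\<phi> \<in> Spec. \<forall>a\<in>AD. \<phi> (\<lambda>x. cnj (a x)) = cnj (\<phi> a)}"

definition weak_star :: "(('n::finite cvec set \<Rightarrow> complex) \<Rightarrow> complex) topology" where
  "weak_star = product_topology (\<lambda>_. euclidean) AD"

definition delta :: "'n::finite cpair set \<Rightarrow> ('n cvec set \<Rightarrow> complex) \<Rightarrow> complex" where
  "delta x = (\<lambda>a\<in>AD. hatA a x)"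

end

theory Submission
  imports Defs "HOL-Complex_Analysis.Complex_Analysis"
begin

unbundle no fps_syntax

text \<open>
  The main point is that every continuous character \<open>\<phi>\<close> is a point evaluation. The numbers
  \<open>\<phi>(p\<^sup>i q\<^sup>j)\<close> form a rank one matrix with the right trace and thus
  determine a point of \<open>hatD\<close> at which \<open>\<phi>\<close> agrees with evaluation on polynomials in
  \<open>p\<^sup>i q\<^sup>j\<close>, so it suffices that these are dense. On \<open>hatZ\<close>, given by
  \<open>p\<^sup>0 q\<^sup>0 = c(w)\<close> where \<open>w\<close> collects the other coordinates, the circle action
  \<open>(\<zeta> p\<^sup>0, q\<^sup>0 / \<zeta>, w)\<close> splits a holomorphic function \<open>f\<close> into Laurent components, and
  these have the form \<open>(p\<^sup>0)\<^sup>k A\<^sub>k(w)\<close> or \<open>(q\<^sup>0)\<^sup>k A\<^sub>k(w)\<close> with \<open>A\<^sub>k\<close> entire.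
  Expanding \<open>A\<^sub>k\<close> one variable at a time approximates \<open>f\<close> by polynomials in \<open>p, q\<close>, and
  averaging over \<open>U(1)\<close> retains the monomials of equal degree in \<open>p\<close> and \<open>q\<close>.

  The extension \<open>hatA a\<close> is unique because a function vanishing on the diagonal \<open>(r, cnj r)\<close> vanishes
  along complexified real lines through it, hence near \<open>(e\<^sub>0, e\<^sub>0)\<close>, hence along every complex
  line through that point.
\<close>

subsection \<open>Laurent coefficients on the punctured plane\<close>

text \<open>All arguments live on \<open>hatZ\<close> with functions invariant under
  \<open>wact\<close>; the quotient gets no charts, and holomorphy is tested along holomorphic
  curves in \<open>hatZ\<close>, so that one-variable theory suffices. The obstacle to polynomial
  approximation is that p0 and q0 have zeros, so a component of weight k cannot simply be divided by
  the k-th power of p0. Instead its cofactor is obtained by integrating f over the points (z,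
  c(w)/z, w) with z on the unit circle. These lie in \<open>hatZ\<close> for every w whatsoever, so
  the cofactor is defined and entire on the whole ambient space; the power of p0 appears when the
  circle through p0 is deformed to the unit circle. Negative weights use (z c(w), 1/z, w) in the
  same way. Density is enough because a continuous character is bounded by suprema over finitely
  many compact sets, and these lift to one closed norm ball of \<open>hatZ\<close>. That ball is
  stable under unit scalars, so the averaging does not increase the error.\<close>

definition circ :: "real \<Rightarrow> complex" where
  "circ t = exp (2 * of_real pi * \<i> * of_real t)"

text \<open>The Laurent coefficient at 0. Parametrising the circle by [0,1] absorbs the factor 1 /
  (2 pi i), and a plain real integral turns dependence on further variables into a matter of
  parameter integrals.\<close>

definition lcoeff :: "int \<Rightarrow> (complex \<Rightarrow> complex) \<Rightarrow> complex" where
  "lcoeff k h = integral {0..1} (\<lambda>t. h (circ t) * circ t powi (- k))"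

lemma circ_nz [simp]: "circ t \<noteq> 0" and norm_circ [simp]: "cmod (circ t) = 1"
  by (auto simp: circ_def norm_exp_eq_Re)

lemma continuous_circ [continuous_intros]: "continuous_on S circ"
  unfolding circ_def by (intro continuous_intros)

lemma continuous_circ_comp [continuous_intros]:
  "continuous_on S f \<Longrightarrow> continuous_on S (\<lambda>x. circ (f x))"
  unfolding circ_def by (intro continuous_intros)

lemma lcoeff_integrand_continuous:
  assumes "continuous_on (-{0}) h"
  shows "continuous_on S (\<lambda>t. h (circ t) * circ t powi k)"
  by (intro continuous_intros continuous_on_compose2[OF assms]) auto

lemma lcoeff_integrable:
  assumes "continuous_on (-{0}) h"
  shows "(\<lambda>t. h (circ t) * circ t powi k) integrable_on {0..1}"
  by (intro integrable_continuous_interval lcoeff_integrand_continuous assms)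

text \<open>Along \<open>a * circ t\<close> the differential is 2 pi i z dt, whose factor z raises
  the exponent \<open>- k - 1\<close> to \<open>- k\<close>. This makes Cauchy's theorem available
  for averages over a circle.\<close>

lemma contour_integral_exp_circle:
  assumes "a \<noteq> 0"
  shows "contour_integral (\<lambda>t. a * circ t) (\<lambda>z. h z * z powi (- k - 1))
       = 2 * pi * \<i> * a powi (- k) * lcoeff k (\<lambda>z. h (a * z))"
proof -
  have d: "((\<lambda>t. a * circ t) has_vector_derivative (2 * pi * \<i> * (a * circ t))) (at t)" for t
  proof -
    have "((\<lambda>z. a * exp (2 * of_real pi * \<i> * z)) has_field_derivative (2 * pi * \<i> * (a * circ t))) (at (of_real t))"
      unfolding circ_def by (auto intro!: derivative_eq_intros)
    from has_vector_derivative_real_field[OF this] show ?thesis by (simp add: circ_def)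
  qed
  have "contour_integral (\<lambda>t. a * circ t) (\<lambda>z. h z * z powi (- k - 1))
      = integral {0..1} (\<lambda>t. (h (a * circ t) * (a * circ t) powi (- k - 1)) * (2 * pi * \<i> * (a * circ t)))"
    by (simp add: contour_integral_integral vector_derivative_at[OF d])
  also have "\<dots> = integral {0..1} (\<lambda>t. (2 * pi * \<i> * a powi (- k)) * (h (a * circ t) * circ t powi (- k)))"
  proof (rule integral_cong)
    fix t
    have "(a * circ t) powi (- k - 1) * (a * circ t) = (a * circ t) powi (- k)"
      using assms by (subst power_int_add_1[symmetric]) auto
    then show "(h (a * circ t) * (a * circ t) powi (- k - 1)) * (2 * pi * \<i> * (a * circ t))
      = (2 * pi * \<i> * a powi (- k)) * (h (a * circ t) * circ t powi (- k))"
      by (simp add: power_int_mult_distrib mult_ac)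
  qed
  finally show ?thesis by (simp add: lcoeff_def)
qed

text \<open>The loops \<open>circ t\<close> and \<open>a * circ t\<close> are homotopic in the
  punctured plane. For positive \<open>a\<close> this changes the radius; for \<open>a\<close> a
  coordinate of a point it pulls a power of that coordinate out of a coefficient.\<close>

lemma lcoeff_scale:
  assumes h: "h holomorphic_on -{0}" and a: "a \<noteq> 0"
  shows "lcoeff k (\<lambda>z. h (a * z)) = a powi k * lcoeff k h"
proof -
  have vp: "valid_path (\<lambda>t. b * circ t)" for b
  proof -
    have "valid_path ((\<lambda>z. b * z) \<circ> circlepath 0 1)"
      by (rule valid_path_compose_holomorphic[where S = UNIV]) (auto intro!: holomorphic_intros)
    moreover have "(\<lambda>z. b * z) \<circ> circlepath 0 1 = (\<lambda>t. b * circ t)"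
      by (auto simp: fun_eq_iff circlepath circ_def)
    ultimately show ?thesis by simp
  qed
  have per: "circ 1 = circ 0" unfolding circ_def by (simp add: exp_eq_polar)
  \<comment> \<open>\<open>exp (s * Ln a)\<close> runs from 1 to \<open>a\<close> without meeting
    0.\<close>
  define H where "H = (\<lambda>(s::real, t::real). exp (of_real s * Ln a) * circ t)"
  have "homotopic_loops (-{0}) (\<lambda>t. 1 * circ t) (\<lambda>t. a * circ t)"
    unfolding homotopic_loops
  proof (intro exI[of _ H] conjI ballI)
    show "continuous_on ({0..1} \<times> {0..1}) H"
      unfolding H_def case_prod_unfold by (intro continuous_intros)
    show "H \<in> {0..1} \<times> {0..1} \<rightarrow> -{0}" by (auto simp: H_def)
  qed (use a in \<open>auto simp: H_def pathfinish_def pathstart_def per\<close>)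
  then have "contour_integral (\<lambda>t. 1 * circ t) (\<lambda>z. h z * z powi (- k - 1))
           = contour_integral (\<lambda>t. a * circ t) (\<lambda>z. h z * z powi (- k - 1))"
    by (rule Cauchy_theorem_homotopic_loops)
       (use vp[of a] vp[of 1] in \<open>auto intro!: holomorphic_intros h\<close>)
  then show ?thesis
    unfolding contour_integral_exp_circle[OF a] contour_integral_exp_circle[OF one_neq_zero]
    using a by (simp add: power_int_minus field_simps)
qed

lemma lcoeff_bound:
  assumes h: "continuous_on (-{0}) h" and B: "\<And>z. cmod z = 1 \<Longrightarrow> cmod (h z) \<le> B"
  shows "cmod (lcoeff k h) \<le> B"
proof -
  have "cmod (lcoeff k h) \<le> B * (1 - 0)"
    unfolding lcoeff_def
    by (intro integral_bound lcoeff_integrand_continuous h)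
       (auto simp: norm_mult norm_power_int B)
  then show ?thesis by simp
qed

lemma lcoeff_bound_radius:
  assumes h: "h holomorphic_on -{0}" and r: "r > 0"
    and B: "\<And>z. cmod z = r \<Longrightarrow> cmod (h z) \<le> B"
  shows "cmod (lcoeff k h) \<le> B * r powi (- k)"
proof -
  have "(\<lambda>z. h (of_real r * z)) holomorphic_on -{0}"
    by (rule holomorphic_on_compose_gen[OF _ h, unfolded o_def]) (use r in \<open>auto intro!: holomorphic_intros\<close>)
  then have "cmod (lcoeff k (\<lambda>z. h (of_real r * z))) \<le> B"
    using r by (intro lcoeff_bound holomorphic_on_imp_continuous_on B) (auto simp: norm_mult)
  then have "r powi k * cmod (lcoeff k h) \<le> B"
    using r by (subst (asm) lcoeff_scale[OF h]) (auto simp: norm_mult norm_power_int)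
  then show ?thesis
    using r by (simp add: power_int_minus field_simps)
qed

lemma circlepath_circ: "circlepath 0 1 = circ"
  by (auto simp: fun_eq_iff circlepath circ_def)

text \<open>For \<open>k < 0\<close> the exponent \<open>- k - 1\<close> is nonnegative, so the
  integrand is entire.\<close>

lemma lcoeff_entire_neg:
  assumes h: "h holomorphic_on UNIV" and k: "k < 0"
  shows "lcoeff k h = 0"
proof -
  have "contour_integral (circlepath 0 1) (\<lambda>z. h z * z powi (- k - 1)) = 0"
    using k by (intro contour_integral_unique Cauchy_theorem_convex_simple[where S = UNIV])
               (auto intro!: holomorphic_intros h)
  then show ?thesis
    using contour_integral_exp_circle[OF one_neq_zero, of h k] by (simp add: circlepath_circ)
qed

lemma lcoeff_entire_0:
  assumes h: "h holomorphic_on UNIV"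
  shows "lcoeff 0 h = h 0"
proof -
  have "contour_integral (circlepath 0 1) (\<lambda>u. h u / (u - 0)) = 2 * pi * \<i> * h 0"
    using Cauchy_integral_circlepath_simple[OF holomorphic_on_subset[OF h], of 0 1 0]
    by (intro contour_integral_unique) simp
  then show ?thesis
    using contour_integral_exp_circle[OF one_neq_zero, of h 0] 
    by (simp add: circlepath_circ power_int_minus divide_inverse)
qed

text \<open>Replacing z by 2 z does not change a constant but multiplies the coefficient by
  \<open>2 powi k\<close>, which differs from 1 unless \<open>k = 0\<close>.\<close>

lemma lcoeff_const: "lcoeff k (\<lambda>_. c) = (if k = 0 then c else 0)"
proof (cases "k = 0")
  case True then show ?thesis using lcoeff_entire_0[of "\<lambda>_. c"] by simp
next
  case False
  have "lcoeff k (\<lambda>z. c) = 2 powi k * lcoeff k (\<lambda>_. c)"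
    using lcoeff_scale[of "\<lambda>_. c" 2 k] by simp
  moreover have "(2::complex) powi k \<noteq> 1"
  proof
    assume "(2::complex) powi k = 1"
    then have "cmod (2 powi k) = 1" by simp
    then have "(2::real) powi k = 1" by (simp add: norm_power_int)
    then show False
      using False power_int_strict_increasing[of 0 k "2::real"] power_int_strict_increasing[of k 0 "2::real"]
      by (cases "k > 0") auto
  qed
  ultimately show ?thesis using False by auto
qed

text \<open>
  The partial sums telescope: with \<open>h = h 1 + (z - 1) D\<close>, the \<open>k\<close>-th coefficient of \<open>h\<close> is, for \<open>k \<noteq> 0\<close>,
  a difference of two consecutive coefficients of \<open>D\<close>.
\<close>
lemma laurent_partial_sum:
  assumes h: "h holomorphic_on -{0}"
    and B: "\<And>z. 1/2 \<le> cmod z \<Longrightarrow> cmod z \<le> 2 \<Longrightarrow> cmod (h z) \<le> B"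
  shows "cmod (h 1 - (\<Sum>k = - int M..int M. lcoeff k h)) \<le> 4 * B / 2 ^ M"
proof -
  \<comment> \<open>The value at 1 removes the singularity of the difference quotient.\<close>
  define D where "D = (\<lambda>z. if z = 1 then deriv h 1 else (h z - h 1) / (z - 1))"
  have der: "deriv (\<lambda>z. h z - h 1) 1 = deriv h 1"
    using holomorphic_on_imp_differentiable_at[OF h, of 1] by (subst deriv_diff) auto
  have D: "D holomorphic_on -{0}"
  proof (rule pole_theorem_open_0)
    show "(\<lambda>z. h z - h 1) holomorphic_on -{0}" by (intro holomorphic_intros h)
  qed (auto simp: D_def der)
  have Dc: "continuous_on (-{0}) D" by (rule holomorphic_on_imp_continuous_on[OF D])
  have heq: "h = (\<lambda>z. h 1 + (z * D z - D z))"
    by (auto simp: D_def fun_eq_iff divide_simps algebra_simps)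
  have step: "lcoeff k h = (if k = 0 then h 1 else 0) + (lcoeff (k - 1) D - lcoeff k D)" for k
  proof -
    have zD: "continuous_on (-{0}) (\<lambda>z. z * D z)" by (intro continuous_intros Dc)
    have "lcoeff k h = integral {0..1} (\<lambda>t. h 1 * circ t powi (- k) + (circ t * D (circ t) * circ t powi (- k) - D (circ t) * circ t powi (- k)))"
      unfolding lcoeff_def by (subst heq) (simp add: algebra_simps)
    also have "\<dots> = lcoeff k (\<lambda>_. h 1) + (lcoeff k (\<lambda>z. z * D z) - lcoeff k D)"
      unfolding lcoeff_def
      using lcoeff_integrable[OF zD] lcoeff_integrable[OF Dc] lcoeff_integrable[of "\<lambda>_. h 1"]
      by (subst integral_add integral_diff; (intro integrable_diff)?; simp)+
    also have "lcoeff k (\<lambda>z. z * D z) = lcoeff (k - 1) D"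
      unfolding lcoeff_def
    proof (rule integral_cong)
      fix t
      have "circ t powi (- (k - 1)) = circ t powi (- k) * circ t"
        by (subst power_int_add_1[symmetric]) auto
      then show "circ t * D (circ t) * circ t powi (- k) = D (circ t) * circ t powi (- (k - 1))"
        by simp
    qed
    finally show ?thesis by (simp add: lcoeff_const)
  qed
  have tele: "(\<Sum>k = - int M..int M. lcoeff k h) = h 1 + lcoeff (- int M - 1) D - lcoeff (int M) D"
  proof (induction M)
    case 0 then show ?case by (simp add: step)
  next
    case (Suc M)
    have "{- int (Suc M)..int (Suc M)} = insert (- int (Suc M)) (insert (int (Suc M)) {- int M..int M})"
      by auto
    then have "(\<Sum>k = - int (Suc M)..int (Suc M). lcoeff k h)
       = lcoeff (- int (Suc M)) h + (lcoeff (int (Suc M)) h + (\<Sum>k = - int M..int M. lcoeff k h))"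
      by simp
    then have "(\<Sum>k = - int (Suc M)..int (Suc M). lcoeff k h)
       = lcoeff (- int (Suc M)) h + (lcoeff (int (Suc M)) h + (h 1 + lcoeff (- int M - 1) D - lcoeff (int M) D))"
      unfolding Suc .
    then show ?case by (simp only: step[of "- int (Suc M)"] step[of "int (Suc M)"])
        (simp add: algebra_simps diff_diff_eq minus_diff_commute)
  qed
  have B0: "cmod (h 1) \<le> B" using B[of 1] by simp
  \<comment> \<open>The coefficient of index \<open>M\<close> is estimated on radius 2 and that of
    index \<open>- M - 1\<close> on radius 1/2, so that both decay. There
    \<open>cmod (z - 1)\<close> is at least 1 and 1/2 respectively, whence \<open>2 * B\<close> and
    \<open>4 * B\<close>.\<close>
  have b2: "cmod (D z) \<le> 2 * B" if "cmod z = 2" for z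
  proof -
    have "1 \<le> cmod (z - 1)" using norm_triangle_ineq2[of z 1] that by simp
    moreover have "cmod (h z - h 1) \<le> 2 * B"
      using norm_triangle_ineq4[of "h z" "h 1"] B[of z] B0 that by simp
    moreover have "cmod (D z) * cmod (z - 1) = cmod (h z - h 1)"
      using that by (auto simp: D_def norm_divide)
    ultimately show ?thesis
      using mult_left_mono[of 1 "cmod (z - 1)" "cmod (D z)"] by simp
  qed
  have b1: "cmod (D z) \<le> 4 * B" if "cmod z = 1/2" for z
  proof -
    have "1/2 \<le> cmod (z - 1)" using norm_triangle_ineq3[of z 1] that by simp
    moreover have "cmod (h z - h 1) \<le> 2 * B"
      using norm_triangle_ineq4[of "h z" "h 1"] B[of z] B0 that by simp
    moreover have "cmod (D z) * cmod (z - 1) = cmod (h z - h 1)"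
      using that by (auto simp: D_def norm_divide)
    ultimately have "cmod (D z) * (1/2) \<le> 2 * B"
      using mult_left_mono[of "1/2" "cmod (z - 1)" "cmod (D z)"] by simp
    then show ?thesis by simp
  qed
  have "cmod (lcoeff (int M) D) \<le> 2 * B * 2 powi (- int M)"
    by (rule lcoeff_bound_radius[OF D]) (auto intro: b2)
  moreover have "cmod (lcoeff (- int M - 1) D) \<le> 4 * B * (1/2) powi (- (- int M - 1))"
    by (rule lcoeff_bound_radius[OF D]) (auto intro: b1)
  \<comment> \<open>The index \<open>- M - 1\<close> yields the exponent \<open>M + 1\<close>; its
    extra factor 1/2 brings \<open>4 * B\<close> down to \<open>2 * B\<close>.\<close>
  moreover have "(1/2) powi (- (- int M - 1)) = 1 / 2 ^ M / (2::real)"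
    using power_int_add_1[of "1/2::real" "int M"] by (simp add: power_one_over add.commute)
  ultimately have "cmod (lcoeff (int M) D) \<le> 2 * B / 2 ^ M" "cmod (lcoeff (- int M - 1) D) \<le> 2 * B / 2 ^ M"
    by (auto simp: power_int_minus field_simps)
  moreover have "h 1 - (\<Sum>k = - int M..int M. lcoeff k h) = lcoeff (int M) D - lcoeff (- int M - 1) D"
    unfolding tele by simp
  moreover have "4 * B / 2 ^ M = 2 * B / 2 ^ M + 2 * B / 2 ^ M"
    by (simp add: add_divide_distrib[symmetric])
  ultimately show ?thesis
    using norm_triangle_ineq4[of "lcoeff (int M) D" "lcoeff (- int M - 1) D"] by simp
qed

text \<open>Morera's theorem: the integral along a triangle is interchanged with the parameter
  integral and vanishes for each fixed parameter.\<close>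

lemma holomorphic_integral_param:
  fixes F :: "complex \<Rightarrow> real \<Rightarrow> complex"
  assumes cont: "continuous_on (UNIV \<times> {0..1}) (\<lambda>(z, t). F z t)"
    and hol: "\<And>t. t \<in> {0..1} \<Longrightarrow> (\<lambda>z. F z t) holomorphic_on UNIV"
  shows "(\<lambda>z. integral {0..1} (F z)) holomorphic_on UNIV"
proof -
  \<comment> \<open>Written along the segment from 0 to 1 with \<open>Re s\<close> as the parameter,
    the integral falls under the interchange rule for two contours.\<close>
  have eq: "integral {0..1} (F z) = contour_integral (linepath 0 1) (\<lambda>s. F z (Re s))" for z
    by (simp add: contour_integral_integral linepath_def scaleR_conv_of_real)
  have img: "path_image (linepath 0 (1::complex)) \<subseteq> {s. Re s \<in> {0..1}}"
    by (auto simp: closed_segment_def)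
  have c1: "continuous_on (A \<times> path_image (linepath 0 1)) (\<lambda>(z, s). F z (Re s))" for A
  proof -
    have "continuous_on (A \<times> path_image (linepath 0 1)) (\<lambda>x. (\<lambda>(z, t). F z t) (fst x, Re (snd x)))"
      by (rule continuous_on_compose2[OF cont])
         (use img in \<open>auto intro!: continuous_intros\<close>)
    then show ?thesis by (simp add: case_prod_unfold)
  qed
  have cz: "continuous_on UNIV (\<lambda>z. integral {0..1} (F z))"
    using integral_continuous_on_param[of UNIV "0::real" 1 F] cont by simp
  have sw: "contour_integral (linepath a b) (\<lambda>z. integral {0..1} (F z))
      = contour_integral (linepath 0 1) (\<lambda>s. contour_integral (linepath a b) (\<lambda>z. F z (Re s)))" for a b
    unfolding eq by (rule contour_integral_swap) (use c1 in \<open>auto\<close>)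
  have ci: "(\<lambda>s. contour_integral (linepath a b) (\<lambda>z. F z (Re s))) contour_integrable_on (linepath 0 1)" for a b
  proof (rule contour_integrable_continuous_linepath)
    have "continuous_on (closed_segment 0 1) (\<lambda>s. integral {0..1} (\<lambda>x. F (linepath a b x) (Re s) * (b - a)))"
    proof -
      have "continuous_on (closed_segment 0 1 \<times> {0..1}) (\<lambda>x. (\<lambda>(z, s). F z (Re s)) (linepath a b (snd x), fst x))"
        by (rule continuous_on_compose2[OF c1[of UNIV]]) (auto intro!: continuous_intros continuous_on_compose2[OF continuous_on_linepath])
      then have "continuous_on (closed_segment 0 1 \<times> {0..1}) (\<lambda>(s, x). F (linepath a b x) (Re s) * (b - a))"
        unfolding case_prod_unfold by (intro continuous_intros) simp
      then show ?thesis
        using integral_continuous_on_param[of "closed_segment 0 (1::complex)" "0::real" 1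
          "\<lambda>s x. F (linepath a b x) (Re s) * (b - a)"] by simp
    qed
    then show "continuous_on (closed_segment 0 1) (\<lambda>s. contour_integral (linepath a b) (\<lambda>z. F z (Re s)))"
      by (simp add: contour_integral_integral)
  qed
  have "(\<lambda>z. integral {0..1} (F z)) analytic_on UNIV"
  proof (rule Morera_triangle)
    fix a b c :: complex
    have tri: "contour_integral (linepath a b) (\<lambda>z. F z (Re s)) + contour_integral (linepath b c) (\<lambda>z. F z (Re s))
       + contour_integral (linepath c a) (\<lambda>z. F z (Re s)) = 0" if "s \<in> path_image (linepath 0 1)" for s
    proof -
      have hs: "(\<lambda>z. F z (Re s)) holomorphic_on UNIV" using hol that img by auto
      have "((\<lambda>z. F z (Re s)) has_contour_integral 0) (linepath a b +++ linepath b c +++ linepath c a)"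
        by (rule Cauchy_theorem_triangle) (rule holomorphic_on_subset[OF hs], auto)
      moreover have ci: "(\<lambda>z. F z (Re s)) contour_integrable_on linepath x y" for x y
        by (intro contour_integrable_continuous_linepath holomorphic_on_imp_continuous_on holomorphic_on_subset[OF hs]) auto
      ultimately show ?thesis
        using contour_integral_unique
        by (fastforce simp: contour_integral_join ci contour_integrable_joinI valid_path_join add.assoc)
    qed
    have "contour_integral (linepath a b) (\<lambda>z. integral {0..1} (F z)) +
          contour_integral (linepath b c) (\<lambda>z. integral {0..1} (F z)) +
          contour_integral (linepath c a) (\<lambda>z. integral {0..1} (F z)) = 0"
      unfolding sw
      apply (subst contour_integral_add[symmetric], rule ci, rule ci)
      apply (subst contour_integral_add[symmetric], intro contour_integrable_add ci, rule ci)
      using tri by (subst contour_integral_eq[where g="\<lambda>_. 0"]) auto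
    then show "convex hull {a, b, c} \<subseteq> UNIV \<longrightarrow> contour_integral (linepath a b) (\<lambda>z. integral {0..1} (F z)) +
          contour_integral (linepath b c) (\<lambda>z. integral {0..1} (F z)) +
          contour_integral (linepath c a) (\<lambda>z. integral {0..1} (F z)) = 0" by simp
  qed (use cz in auto)
  then show ?thesis by (simp add: analytic_on_open)
qed

text \<open>The reflection of \<open>t\<close> to \<open>1 - t\<close> inverts
  \<open>circ t\<close>.\<close>

lemma lcoeff_inverse: "lcoeff k (\<lambda>z. h (1 / z)) = lcoeff (- k) h"
proof -
  have c: "circ (1 - t) = 1 / circ t" for t
  proof -
    have "circ (1 - t) * circ t = exp (2 * of_real pi * \<i>)"
      unfolding circ_def exp_add[symmetric] by (simp add: algebra_simps)
    then show ?thesis by (simp add: field_simps)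
  qed
  have "integral {0..1} (\<lambda>t. h (circ (1 - t)) * circ (1 - t) powi k) = integral {0..1} (\<lambda>t. h (circ t) * circ t powi k)"
    using Henstock_Kurzweil_Integration.integral_reflect_real[where a = "-1" and b = 0 and f = "\<lambda>t. h (circ (1 + t)) * circ (1 + t) powi k"]
      integral_shift_real_ivl[where f = "\<lambda>t. h (circ t) * circ t powi k" and a = 0 and b = 1 and c = 1]
    by (simp add: add.commute)
  then show ?thesis
    unfolding lcoeff_def c by (simp add: power_int_minus power_int_divide_distrib power_int_inverse divide_inverse)
qed

section \<open>Holomorphic functions on \<open>hatZ\<close> and their restrictions to curves\<close>

definition bform :: "'n::finite cpair \<Rightarrow> complex" where
  "bform w = - (fst w $ None * snd w $ None) + (\<Sum>i\<in>UNIV. fst w $ Some i * snd w $ Some i)"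

lemma mem_hatZ: "w \<in> hatZ \<longleftrightarrow> bform w = -1"
  by (auto simp: hatZ_def bform_def case_prod_unfold)

definition hcurve :: "complex set \<Rightarrow> (complex \<Rightarrow> 'n::finite cpair) \<Rightarrow> bool" where
  "hcurve S c \<longleftrightarrow> (\<forall>i. (\<lambda>t. fst (c t) $ i) holomorphic_on S \<and> (\<lambda>t. snd (c t) $ i) holomorphic_on S)"

lemma vec_has_derivative:
  fixes P :: "complex \<Rightarrow> complex ^ 'm::finite"
  assumes "\<And>i. ((\<lambda>t. P t $ i) has_field_derivative v $ i) (at t0)"
  shows "(P has_derivative (\<lambda>h. h *s v)) (at t0)"
proof -
  have bl: "bounded_linear (\<lambda>x::complex. x *s (axis i 1 :: complex ^ 'm))" for i
    unfolding linear_conv_bounded_linear[symmetric]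
    by (intro linearI) (auto simp: vec_eq_iff algebra_simps)
  have "((\<lambda>t. \<Sum>i\<in>UNIV. P t $ i *s axis i 1) has_derivative (\<lambda>h. \<Sum>i\<in>UNIV. (v $ i * h) *s axis i 1)) (at t0)"
    using assms by (intro has_derivative_sum bounded_linear.has_derivative[OF bl])
       (auto simp: has_field_derivative_def)
  moreover have "(\<lambda>h. \<Sum>i\<in>UNIV. (v $ i * h) *s axis i 1) = (\<lambda>h. h *s v)"
    by (auto simp: fun_eq_iff vec_eq_iff axis_def if_distrib cong: if_cong)
  ultimately show ?thesis by (simp add: basis_expansion)
qed

lemma cscale_decomp: "cscale h v = Re h *\<^sub>R v + Im h *\<^sub>R cscale \<i> v"
proof -
  have "h * x = Re h *\<^sub>R x + Im h *\<^sub>R (\<i> * x)" for x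
    by (simp add: complex_eq_iff)
  then show ?thesis by (auto simp: cscale_def prod_eq_iff vec_eq_iff)
qed

text \<open>Chain rule for a local extension \<open>G\<close>: since its differential
  \<open>L\<close> is complex-linear, \<open>L v\<close> is the complex derivative along the
  velocity \<open>v\<close>. Apart from continuity and closure properties, holomorphy on
  \<open>hatZ\<close> enters later arguments only through this lemma.\<close>

lemma holo_hatZ_curve:
  fixes f :: "'n::finite cpair \<Rightarrow> complex"
  assumes f: "holo_hatZ f" and S: "open S" and c: "hcurve S c" and im: "c ` S \<subseteq> hatZ"
  shows "(\<lambda>t. f (c t)) holomorphic_on S"
  unfolding holomorphic_on_open[OF S]
proof
  fix t0 assume t0: "t0 \<in> S"
  define v where "v = ((\<chi> i. deriv (\<lambda>t. fst (c t) $ i) t0), (\<chi> i. deriv (\<lambda>t. snd (c t) $ i) t0))"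
  have cd: "(c has_derivative (\<lambda>h. cscale h v)) (at t0)"
  proof -
    have "((\<lambda>t. fst (c t)) has_derivative (\<lambda>h. h *s fst v)) (at t0)" "((\<lambda>t. snd (c t)) has_derivative (\<lambda>h. h *s snd v)) (at t0)"
      using c t0 S by (auto intro!: vec_has_derivative holomorphic_derivI[where S = S] simp: v_def hcurve_def)
    then have "((\<lambda>t. (fst (c t), snd (c t))) has_derivative (\<lambda>h. cscale h v)) (at t0)"
      unfolding cscale_def by (rule has_derivative_Pair)
    then show ?thesis by simp
  qed
  have "c t0 \<in> hatZ" using im t0 by blast
  then obtain U G where U: "c t0 \<in> U" "holo_open U G" and G: "\<forall>w\<in>U \<inter> hatZ. G w = f w"
    using f unfolding holo_hatZ_def by blast
  then obtain L where L: "(G has_derivative L) (at (c t0))" "\<And>v. L (cscale \<i> v) = \<i> * L v"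
    unfolding holo_open_def by blast
  have "open U" using U by (simp add: holo_open_def)
  have "linear L" using L(1) has_derivative_linear by blast
  then have "L (cscale h v) = L v * h" for h
    unfolding cscale_decomp[of h]
    by (simp add: linear_add linear_scale L(2)) (simp add: complex_eq_iff)
  moreover have "((\<lambda>t. G (c t)) has_derivative (\<lambda>h. L (cscale h v))) (at t0)"
    using has_derivative_compose[OF cd L(1)] by simp
  ultimately have "((\<lambda>t. G (c t)) has_field_derivative L v) (at t0)"
    by (simp add: has_field_derivative_def)
  moreover have "\<forall>\<^sub>F t in nhds t0. t \<in> S" using S t0 by (rule eventually_nhds_in_open)
  moreover have "isCont c t0" using cd has_derivative_continuous by blast
  then have "\<forall>\<^sub>F t in nhds t0. c t \<in> U"
    using \<open>open U\<close> U(1) by (simp add: isCont_def tendsto_at_iff_tendsto_nhds topological_tendstoD)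
  ultimately have "((\<lambda>t. G (c t)) has_field_derivative L v) (at t0)"
      and "\<forall>\<^sub>F t in nhds t0. t \<in> S \<and> c t \<in> U"
    by (auto simp: eventually_conj_iff)
  moreover from this(2) have "\<forall>\<^sub>F t in nhds t0. f (c t) = G (c t)"
    by (rule eventually_mono) (use G im in \<open>auto simp: image_subset_iff\<close>)
  ultimately have "((\<lambda>t. f (c t)) has_field_derivative L v) (at t0)"
    by (subst DERIV_cong_ev[OF refl _ refl])
  then show "\<exists>f'. ((\<lambda>t. f (c t)) has_field_derivative f') (at t0)" by blast
qed

lemma holo_hatZ_continuous:
  assumes "holo_hatZ f" shows "continuous_on hatZ f"
  unfolding continuous_on_eq_continuous_within
proof
  fix w :: "'a cpair" assume w: "w \<in> hatZ"
  then obtain U G L where U: "w \<in> U" "open U" and G: "\<And>v. v \<in> U \<inter> hatZ \<Longrightarrow> G v = f v"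
    and "(G has_derivative L) (at w)"
    using assms unfolding holo_hatZ_def holo_open_def by meson
  then have "continuous (at w within hatZ) G"
    using has_derivative_continuous continuous_at_imp_continuous_at_within by blast
  moreover have "\<forall>\<^sub>F v in at w within hatZ. G v = f v"
    using G U unfolding eventually_at_topological by blast
  ultimately show "continuous (at w within hatZ) f"
    unfolding continuous_within using G[of w] U w tendsto_cong[of G f "at w within hatZ"] by simp
qed

lemma holo_hatZ_cong:
  assumes "\<And>w. w \<in> hatZ \<Longrightarrow> f w = g w" shows "holo_hatZ f \<longleftrightarrow> holo_hatZ g"
proof -
  have "(\<forall>v\<in>U \<inter> hatZ. G v = f v) \<longleftrightarrow> (\<forall>v\<in>U \<inter> hatZ. G v = g v)" for U G
    using assms by auto
  then show ?thesis unfolding holo_hatZ_def by simp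
qed

lemma holo_hatZ_entire:
  assumes "\<And>w. \<exists>L. (G has_derivative L) (at w) \<and> (\<forall>v. L (cscale \<i> v) = \<i> * L v)"
  shows "holo_hatZ G"
proof -
  have "holo_open UNIV G" unfolding holo_open_def using assms by blast
  then show ?thesis unfolding holo_hatZ_def by blast
qed

lemma holo_hatZ_const: "holo_hatZ (\<lambda>_. c)"
  by (rule holo_hatZ_entire) (auto intro!: exI[of _ "\<lambda>_. 0"])

lemma holo_hatZ_coord:
  fixes i :: "'n::finite option"
  shows "holo_hatZ (\<lambda>w. fst w $ i)" and "holo_hatZ (\<lambda>w. snd w $ i)"
proof -
  have "bounded_linear (\<lambda>w::'n cpair. fst w $ i)" "bounded_linear (\<lambda>w::'n cpair. snd w $ i)"
    unfolding linear_conv_bounded_linear[symmetric]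
    by (intro linearI; simp)+
  then have "((\<lambda>w::'n cpair. fst w $ i) has_derivative (\<lambda>w. fst w $ i)) (at x)"
     "((\<lambda>w::'n cpair. snd w $ i) has_derivative (\<lambda>w. snd w $ i)) (at x)" for x
    by (auto intro: bounded_linear_imp_has_derivative)
  then show "holo_hatZ (\<lambda>w::'n cpair. fst w $ i)" "holo_hatZ (\<lambda>w::'n cpair. snd w $ i)"
    by (auto intro!: holo_hatZ_entire exI conjI simp: cscale_def)
qed

lemma holo_hatZ_add:
  assumes "holo_hatZ f" "holo_hatZ g" shows "holo_hatZ (\<lambda>w. f w + g w)"
  unfolding holo_hatZ_def
proof
  fix w :: "'a cpair" assume w: "w \<in> hatZ"
  obtain U G V H where UV: "w \<in> U" "w \<in> V" and h: "holo_open U G" "holo_open V H"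
    and e: "\<forall>v\<in>U \<inter> hatZ. G v = f v" "\<forall>v\<in>V \<inter> hatZ. H v = g v"
    using assms w unfolding holo_hatZ_def by meson
  have "holo_open (U \<inter> V) (\<lambda>w. G w + H w)"
    unfolding holo_open_def
  proof (intro conjI ballI)
    fix x assume x: "x \<in> U \<inter> V"
    obtain L L' where L: "(G has_derivative L) (at x)" "\<forall>v. L (cscale \<i> v) = \<i> * L v"
      and L': "(H has_derivative L') (at x)" "\<forall>v. L' (cscale \<i> v) = \<i> * L' v"
      using h x unfolding holo_open_def by blast
    show "\<exists>L. ((\<lambda>w. G w + H w) has_derivative L) (at x) \<and> (\<forall>v. L (cscale \<i> v) = \<i> * L v)"
      by (rule exI[of _ "\<lambda>v. L v + L' v"]) (use L L' in \<open>simp add: has_derivative_add distrib_left\<close>)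
  qed (use h in \<open>auto simp: holo_open_def\<close>)
  then show "\<exists>U G. w \<in> U \<and> holo_open U G \<and> (\<forall>v\<in>U \<inter> hatZ. G v = f v + g v)"
    using UV e by (intro exI[of _ "U \<inter> V"] exI[of _ "\<lambda>w. G w + H w"]) auto
qed

lemma holo_hatZ_mult:
  assumes "holo_hatZ f" "holo_hatZ g" shows "holo_hatZ (\<lambda>w. f w * g w)"
  unfolding holo_hatZ_def
proof
  fix w :: "'a cpair" assume w: "w \<in> hatZ"
  obtain U G V H where UV: "w \<in> U" "w \<in> V" and h: "holo_open U G" "holo_open V H"
    and e: "\<forall>v\<in>U \<inter> hatZ. G v = f v" "\<forall>v\<in>V \<inter> hatZ. H v = g v"
    using assms w unfolding holo_hatZ_def by meson
  have "holo_open (U \<inter> V) (\<lambda>w. G w * H w)"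
    unfolding holo_open_def
  proof (intro conjI ballI)
    fix x assume x: "x \<in> U \<inter> V"
    obtain L L' where L: "(G has_derivative L) (at x)" "\<forall>v. L (cscale \<i> v) = \<i> * L v"
      and L': "(H has_derivative L') (at x)" "\<forall>v. L' (cscale \<i> v) = \<i> * L' v"
      using h x unfolding holo_open_def by blast
    show "\<exists>L. ((\<lambda>w. G w * H w) has_derivative L) (at x) \<and> (\<forall>v. L (cscale \<i> v) = \<i> * L v)"
      by (rule exI[of _ "\<lambda>v. G x * L' v + L v * H x"])
         (use L L' in \<open>simp add: has_derivative_mult distrib_left\<close>)
  qed (use h in \<open>auto simp: holo_open_def\<close>)
  then show "\<exists>U G. w \<in> U \<and> holo_open U G \<and> (\<forall>v\<in>U \<inter> hatZ. G v = f v * g v)"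
    using UV e by (intro exI[of _ "U \<inter> V"] exI[of _ "\<lambda>w. G w * H w"]) auto
qed

text \<open>Lists of indices serve as multi-indices; the degrees in p and q are their
  lengths.\<close>

definition pqmon :: "'n::finite option list \<Rightarrow> 'n option list \<Rightarrow> 'n cpair \<Rightarrow> complex" where
  "pqmon is js w = prod_list (map (\<lambda>i. fst w $ i) is) * prod_list (map (\<lambda>j. snd w $ j) js)"

lemma holo_hatZ_pqmon: "holo_hatZ (pqmon is js)"
proof -
  have "holo_hatZ (\<lambda>w. prod_list (map (\<lambda>i. fst w $ i) is))"
    by (induction "is") (auto intro!: holo_hatZ_const holo_hatZ_mult holo_hatZ_coord)
  moreover have "holo_hatZ (\<lambda>w. prod_list (map (\<lambda>i. snd w $ i) js))"
    by (induction js) (auto intro!: holo_hatZ_const holo_hatZ_mult holo_hatZ_coord)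
  ultimately show ?thesis unfolding pqmon_def by (rule holo_hatZ_mult)
qed

subsection \<open>Uniform polynomial approximation\<close>

inductive pqpoly :: "('n::finite cpair \<Rightarrow> complex) \<Rightarrow> bool" where
  mon: "pqpoly (pqmon is js)"
| add: "pqpoly f \<Longrightarrow> pqpoly g \<Longrightarrow> pqpoly (\<lambda>w. f w + g w)"
| scale: "pqpoly f \<Longrightarrow> pqpoly (\<lambda>w. c * f w)"

text \<open>The sum type indexes the coordinates of p and q together, so that expanding one variable
  at a time is an induction over a single finite set.\<close>

fun coord :: "'n option + 'n option \<Rightarrow> 'n::finite cpair \<Rightarrow> complex" where
  "coord (Inl i) w = fst w $ i"
| "coord (Inr j) w = snd w $ j"

fun upd :: "'n option + 'n option \<Rightarrow> complex \<Rightarrow> 'n::finite cpair \<Rightarrow> 'n cpair" where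
  "upd (Inl i) z w = ((\<chi> k. if k = i then z else fst w $ k), snd w)"
| "upd (Inr j) z w = (fst w, (\<chi> k. if k = j then z else snd w $ k))"

lemma coord_upd: "coord s (upd s' z w) = (if s = s' then z else coord s w)"
  by (cases s; cases s') auto

lemma coord_eqI: "(\<And>s. coord s w = coord s w') \<Longrightarrow> w = w'"
proof -
  assume a: "\<And>s. coord s w = coord s w'"
  show ?thesis using a[of "Inl _"] a[of "Inr _"] by (simp add: prod_eq_iff vec_eq_iff)
qed

lemma upd_coord [simp]: "upd s (coord s w) w = w"
  by (rule coord_eqI) (simp add: coord_upd)

lemma upd_upd_same [simp]: "upd s x (upd s y w) = upd s x w"
  by (rule coord_eqI) (simp add: coord_upd)

lemma upd_commute: "s \<noteq> s' \<Longrightarrow> upd s x (upd s' y w) = upd s' y (upd s x w)"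
  by (rule coord_eqI) (simp add: coord_upd)

lemma continuous_coord [continuous_intros]:
  "continuous_on X f \<Longrightarrow> continuous_on X (\<lambda>x. coord s (f x))"
  by (cases s) (auto intro!: continuous_intros)

lemma continuous_on_cpairI:
  assumes "\<And>s. continuous_on X (\<lambda>x. coord s (f x))"
  shows "continuous_on X f"
proof -
  have "continuous_on X (\<lambda>x. \<chi> i. fst (f x) $ i)" "continuous_on X (\<lambda>x. \<chi> i. snd (f x) $ i)"
    using assms[of "Inl _"] assms[of "Inr _"] by (auto intro!: continuous_on_vec_lambda simp del: vec_lambda_eta)
  then have "continuous_on X (\<lambda>x. (fst (f x), snd (f x)))"
    by (intro continuous_on_Pair) simp_all
  then show ?thesis by simp
qed

lemma continuous_upd [continuous_intros]:
  "continuous_on X f \<Longrightarrow> continuous_on X g \<Longrightarrow> continuous_on X (\<lambda>x. upd s (f x) (g x))"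
  by (rule continuous_on_cpairI, rename_tac s', case_tac "s' = s") (auto simp: coord_upd intro!: continuous_intros)

lemma hcurve_iff: "hcurve S c \<longleftrightarrow> (\<forall>s. (\<lambda>t. coord s (c t)) holomorphic_on S)"
  unfolding hcurve_def by (auto simp: split_sum_all)

lemma pqpoly_coord:
  assumes "pqpoly f" shows "pqpoly (\<lambda>w. coord s w * f w)"
  using assms
proof induction
  case (mon "is" js)
  have "(\<lambda>w. coord s w * pqmon is js w) = (case s of Inl i \<Rightarrow> pqmon (i # is) js | Inr j \<Rightarrow> pqmon is (j # js))"
    by (cases s) (auto simp: pqmon_def fun_eq_iff)
  then show ?case by (cases s) (auto intro: pqpoly.mon)
next
  case (add f g)
  then show ?case using pqpoly.add[of "\<lambda>w. coord s w * f w" "\<lambda>w. coord s w * g w"] by (simp add: distrib_left)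
next
  case (scale f c)
  then show ?case using pqpoly.scale[of "\<lambda>w. coord s w * f w" c] by (simp add: mult.left_commute)
qed

lemma pqpoly_const: "pqpoly (\<lambda>_. c)"
  using pqpoly.scale[OF pqpoly.mon[of "[]" "[]"], of c] by (simp add: pqmon_def)

definition approx :: "'n::finite cpair set \<Rightarrow> ('n cpair \<Rightarrow> complex) \<Rightarrow> bool" where
  "approx X f \<longleftrightarrow> (\<forall>K e. compact K \<longrightarrow> K \<subseteq> X \<longrightarrow> e > 0 \<longrightarrow> (\<exists>h. pqpoly h \<and> (\<forall>w\<in>K. cmod (f w - h w) < e)))"

lemma approxE:
  assumes "approx X f" "compact K" "K \<subseteq> X" "e > 0"
  obtains h where "pqpoly h" "\<And>w. w \<in> K \<Longrightarrow> cmod (f w - h w) < e"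
proof -
  have "\<exists>h. pqpoly h \<and> (\<forall>w\<in>K. cmod (f w - h w) < e)"
    using assms unfolding approx_def by simp
  then show thesis using that by (elim exE conjE) simp
qed

lemma approx_const: "approx X (\<lambda>_. c)"
  unfolding approx_def using pqpoly_const[of c] by (auto intro!: exI[of _ "\<lambda>_. c"])

lemma approx_subset: "approx X f \<Longrightarrow> Y \<subseteq> X \<Longrightarrow> approx Y f"
  unfolding approx_def by (simp add: order_trans[of _ Y X])

lemma approx_cong:
  assumes "approx X f" "\<And>w. w \<in> X \<Longrightarrow> f w = g w" shows "approx X g"
  unfolding approx_def
proof (intro allI impI)
  fix K and e :: real assume K: "compact K" "K \<subseteq> X" "e > 0"
  obtain h where "pqpoly h" "\<And>w. w \<in> K \<Longrightarrow> cmod (f w - h w) < e"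
    using approxE[OF assms(1) K] by blast
  then show "\<exists>h. pqpoly h \<and> (\<forall>w\<in>K. cmod (g w - h w) < e)"
    using assms(2) K(2) by (intro exI[of _ h]) (auto simp: subset_iff)
qed

lemma approx_add:
  assumes "approx X f" "approx X g" shows "approx X (\<lambda>w. f w + g w)"
  unfolding approx_def
proof (intro allI impI)
  fix K and e :: real assume K: "compact K" "K \<subseteq> X" and e: "e > 0"
  have e2: "e / 2 > 0" using e by simp
  obtain h1 where h1: "pqpoly h1" "\<And>w. w \<in> K \<Longrightarrow> cmod (f w - h1 w) < e/2"
    using approxE[OF assms(1) K e2] by blast
  obtain h2 where h2: "pqpoly h2" "\<And>w. w \<in> K \<Longrightarrow> cmod (g w - h2 w) < e/2"
    using approxE[OF assms(2) K e2] by blast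
  have "cmod (f w + g w - (h1 w + h2 w)) < e" if "w \<in> K" for w
    using norm_triangle_ineq[of "f w - h1 w" "g w - h2 w"] h1(2)[OF that] h2(2)[OF that]
    by (simp add: algebra_simps)
  then show "\<exists>h. pqpoly h \<and> (\<forall>w\<in>K. cmod (f w + g w - h w) < e)"
    using pqpoly.add[OF h1(1) h2(1)] by blast
qed

lemma approx_sum: "finite A \<Longrightarrow> (\<And>k. k \<in> A \<Longrightarrow> approx X (f k)) \<Longrightarrow> approx X (\<lambda>w. \<Sum>k\<in>A. f k w)"
  by (induction A rule: finite_induct) (simp_all add: approx_const approx_add)

lemma approx_coord:
  assumes "approx X f" shows "approx X (\<lambda>w. coord s w * f w)"
  unfolding approx_def
proof (intro allI impI)
  fix K and e :: real assume K: "compact K" "K \<subseteq> X" and e: "e > 0"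
  have "bounded (coord s ` K)"
    by (intro compact_imp_bounded compact_continuous_image continuous_intros K)
  then obtain C where C: "C > 0" "\<forall>w\<in>K. cmod (coord s w) \<le> C"
    unfolding bounded_pos by auto
  obtain h where h: "pqpoly h" "\<And>w. w \<in> K \<Longrightarrow> cmod (f w - h w) < e / C"
    using approxE[OF assms K divide_pos_pos[OF e C(1)]] by blast
  have "cmod (coord s w * f w - coord s w * h w) < e" if "w \<in> K" for w
  proof -
    have "cmod (coord s w * f w - coord s w * h w) = cmod (coord s w) * cmod (f w - h w)"
      by (simp add: right_diff_distrib[symmetric] norm_mult)
    also have "\<dots> \<le> C * cmod (f w - h w)" using C that by (simp add: mult_right_mono)
    also have "\<dots> < e" using h(2)[OF that] C(1) by (simp add: field_simps)
    finally show ?thesis .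
  qed
  then show "\<exists>h. pqpoly h \<and> (\<forall>w\<in>K. cmod (coord s w * f w - h w) < e)"
    using pqpoly_coord[OF h(1)] by blast
qed

lemma approx_coord_power: "approx X f \<Longrightarrow> approx X (\<lambda>w. coord s w ^ m * f w)"
  using approx_coord[of X "\<lambda>w. coord s w ^ m * f w" s for m] by (induction m) (simp_all add: mult.assoc)

text \<open>\<open>f w\<close> is the value at \<open>z = 1\<close> of \<open>f (R z w)\<close>,
  whose Laurent partial sums converge at a rate governed by a bound over an annulus. On a compact
  \<open>K\<close> this bound is uniform. Two families \<open>R\<close> are used: scaling one
  ambient coordinate, and on \<open>hatZ\<close> scaling p0 by z and q0 by 1/z.\<close>

lemma approx_fourier:
  assumes f: "continuous_on X f"
    and R1: "\<And>w. w \<in> X \<Longrightarrow> R 1 w = w"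
    and RX: "\<And>z w. z \<noteq> 0 \<Longrightarrow> w \<in> X \<Longrightarrow> R z w \<in> X"
    and Rc: "continuous_on ((-{0}) \<times> X) (\<lambda>(z, w). R z w)"
    and hol: "\<And>w. w \<in> X \<Longrightarrow> (\<lambda>z. f (R z w)) holomorphic_on -{0}"
    and co: "\<And>k. approx X (\<lambda>w. lcoeff k (\<lambda>z. f (R z w)))"
  shows "approx X f"
  unfolding approx_def
proof (intro allI impI)
  fix K and e :: real assume K: "compact K" "K \<subseteq> X" and e: "e > 0"
  \<comment> \<open>The annulus on which \<open>laurent_partial_sum\<close> requires its
    bound.\<close>
  define A where "A = cball 0 2 - ball (0::complex) (1/2)"
  have A: "compact A" "A \<subseteq> -{0}" by (auto simp: A_def compact_diff)
  have "continuous_on (A \<times> K) (\<lambda>x. f ((\<lambda>(z, w). R z w) x))"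
    using A K by (intro continuous_on_compose2[OF f] continuous_on_subset[OF Rc]) (auto intro!: RX)
  then have "bounded ((\<lambda>x. f ((\<lambda>(z, w). R z w) x)) ` (A \<times> K))"
    using A K by (intro compact_imp_bounded compact_continuous_image compact_Times)
  then obtain B where B: "B > 0" "\<And>z w. z \<in> A \<Longrightarrow> w \<in> K \<Longrightarrow> cmod (f (R z w)) \<le> B"
    unfolding bounded_pos by auto
  have "(\<lambda>M. 4 * B * (1 / 2) ^ M) \<longlonglongrightarrow> 4 * B * 0"
    by (intro tendsto_intros LIMSEQ_realpow_zero) auto
  then have "\<forall>\<^sub>F M in sequentially. 4 * B * (1 / 2) ^ M < e / 2"
    by (rule order_tendstoD) (use e in simp)
  then obtain M where M: "4 * B * (1/2) ^ M < e / 2"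
    by (auto simp only: eventually_sequentially)
  have "approx X (\<lambda>w. \<Sum>k = - int M..int M. lcoeff k (\<lambda>z. f (R z w)))"
    by (intro approx_sum co) auto
  then obtain h where h: "pqpoly h"
      "\<And>w. w \<in> K \<Longrightarrow> cmod ((\<Sum>k = - int M..int M. lcoeff k (\<lambda>z. f (R z w))) - h w) < e / 2"
    using approxE[OF _ K half_gt_zero[OF e]] by blast
  have "cmod (f w - h w) < e" if w: "w \<in> K" for w
  proof -
    have "cmod (f (R 1 w) - (\<Sum>k = - int M..int M. lcoeff k (\<lambda>z. f (R z w)))) \<le> 4 * B / 2 ^ M"
      using w K by (intro laurent_partial_sum hol B) (auto simp: A_def)
    then have "cmod (f w - (\<Sum>k = - int M..int M. lcoeff k (\<lambda>z. f (R z w)))) < e / 2"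
      using M R1[of w] w K by (auto simp: power_one_over)
    then show ?thesis
      using norm_diff_triangle_less[OF _ h(2)[OF w]] by fastforce
  qed
  then show "\<exists>h. pqpoly h \<and> (\<forall>w\<in>K. cmod (f w - h w) < e)" using h(1) by blast
qed

text \<open>Joint continuity with holomorphy in each single coordinate is preserved by taking
  Laurent coefficients, and it is all that the induction over coordinates uses.\<close>

definition sep_entire :: "('n::finite cpair \<Rightarrow> complex) \<Rightarrow> bool" where
  "sep_entire g \<longleftrightarrow> continuous_on UNIV g \<and> (\<forall>w s. (\<lambda>z. g (upd s z w)) holomorphic_on UNIV)"

text \<open>\<open>H z w\<close> is controlled for nonzero \<open>z\<close>, as befits the curves
  with a term \<open>cc w / z\<close> below; the circle of integration avoids 0.\<close>

lemma sep_lcoeff: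
  fixes H :: "complex \<Rightarrow> 'n::finite cpair \<Rightarrow> complex"
  assumes c: "continuous_on ((-{0}) \<times> UNIV) (\<lambda>(z, w). H z w)"
    and hol: "\<And>z s w. z \<noteq> 0 \<Longrightarrow> (\<lambda>x. H z (upd s x w)) holomorphic_on UNIV"
  shows "sep_entire (\<lambda>w. lcoeff k (\<lambda>z. H z w))"
  unfolding sep_entire_def
proof (intro conjI allI)
  have "continuous_on (UNIV \<times> {0..1}) (\<lambda>x. (\<lambda>(z, w). H z w) (circ (snd x), fst x))"
    by (rule continuous_on_compose2[OF c]) (auto intro!: continuous_intros)
  then have c1: "continuous_on (UNIV \<times> {0..1}) (\<lambda>(w, t). H (circ t) w * circ t powi (- k))"
    unfolding case_prod_unfold by (intro continuous_intros) auto
  then show "continuous_on UNIV (\<lambda>w. lcoeff k (\<lambda>z. H z w))"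
    unfolding lcoeff_def
    using integral_continuous_on_param[of UNIV "0::real" 1 "\<lambda>w t. H (circ t) w * circ t powi (- k)"] by simp
  fix w :: "'n cpair" and s
  show "(\<lambda>x. lcoeff k (\<lambda>z. H z (upd s x w))) holomorphic_on UNIV"
    unfolding lcoeff_def
  proof (rule holomorphic_integral_param)
    have "continuous_on (UNIV \<times> {0..1}) (\<lambda>x. (\<lambda>(w, t). H (circ t) w * circ t powi (- k)) (upd s (fst x) w, snd x))"
      by (rule continuous_on_compose2[OF c1]) (auto intro!: continuous_intros)
    then show "continuous_on (UNIV \<times> {0..1}) (\<lambda>(x, t). H (circ t) (upd s x w) * circ t powi (- k))"
      by (simp add: case_prod_unfold)
  qed (auto intro!: holomorphic_intros hol)
qed

text \<open>Induction on a set of coordinates determining \<open>g\<close>. The Taylor coefficients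
  of \<open>g\<close> in the coordinate \<open>s\<close> are determined by the remaining ones, and
  \<open>g\<close> is recovered from them and powers of \<open>coord s\<close>.\<close>

lemma sep_approx:
  fixes g :: "'n::finite cpair \<Rightarrow> complex"
  assumes "finite S" "sep_entire g" "\<And>w w'. (\<And>s. s \<in> S \<Longrightarrow> coord s w = coord s w') \<Longrightarrow> g w = g w'"
  shows "approx UNIV g"
  using assms
proof (induction S arbitrary: g rule: finite_induct)
  case empty
  have "g 0 = g w" for w by (rule empty.prems(2)) simp
  then show ?case by (rule approx_cong[OF approx_const])
next
  case (insert s S)
  have gc: "continuous_on UNIV g" and gh: "\<And>w s. (\<lambda>z. g (upd s z w)) holomorphic_on UNIV"
    using insert.prems(1) by (auto simp: sep_entire_def)
  have cc: "approx UNIV (\<lambda>w. lcoeff k (\<lambda>z. g (upd s z w)))" for k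
  proof (rule insert.IH)
    show "sep_entire (\<lambda>w. lcoeff k (\<lambda>z. g (upd s z w)))"
    proof (rule sep_lcoeff)
      show "continuous_on ((- {0}) \<times> UNIV) (\<lambda>(z, w). g (upd s z w))"
        unfolding case_prod_unfold
        by (rule continuous_on_compose2[OF gc]) (auto intro!: continuous_intros)
      show "(\<lambda>x. g (upd s z (upd s' x w))) holomorphic_on UNIV" for z s' w
        using gh[of s' "upd s z w"] by (cases "s = s'") (auto simp: upd_commute)
    qed
    show "lcoeff k (\<lambda>z. g (upd s z w)) = lcoeff k (\<lambda>z. g (upd s z w'))"
      if "\<And>t. t \<in> S \<Longrightarrow> coord t w = coord t w'" for w w'
    proof -
      have "g (upd s z w) = g (upd s z w')" for z
        by (rule insert.prems(2)) (use that in \<open>auto simp: coord_upd\<close>)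
      then show ?thesis by simp
    qed
  qed
  show ?case
  proof (rule approx_fourier[where R = "\<lambda>z w. upd s (z * coord s w) w"])
    show hz: "(\<lambda>z. g (upd s (z * coord s w) w)) holomorphic_on - {0}" for w
      by (rule holomorphic_on_compose_gen[OF _ gh[of s w], unfolded o_def]) (auto intro!: holomorphic_intros)
    show "continuous_on ((- {0}) \<times> UNIV) (\<lambda>(z, w). upd s (z * coord s w) w)"
      unfolding case_prod_unfold by (auto intro!: continuous_intros)
    fix k :: int
    have hz': "(\<lambda>z. g (upd s (z * coord s w) w)) holomorphic_on UNIV" for w
      by (rule holomorphic_on_compose_gen[OF _ gh[of s w], unfolded o_def]) (auto intro!: holomorphic_intros)
    have "lcoeff k (\<lambda>z. g (upd s (z * coord s w) w))
       = (if k < 0 then 0 else coord s w ^ nat k * lcoeff k (\<lambda>z. g (upd s z w)))" for w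
    proof (cases "k < 0")
      case True then show ?thesis using lcoeff_entire_neg[OF hz'] by simp
    next
      case k: False
      show ?thesis
      proof (cases "coord s w = 0")
        case True
        then show ?thesis using k lcoeff_entire_0[OF gh, of s w] by (auto simp: lcoeff_const)
      next
        case False
        then show ?thesis
          using k lcoeff_scale[OF holomorphic_on_subset[OF gh, of "-{0}" s w] False, of k]
          by (simp add: mult.commute[of "coord s w"] power_int_def)
      qed
    qed
    then show "approx UNIV (\<lambda>w. lcoeff k (\<lambda>z. g (upd s (z * coord s w) w)))"
      using approx_coord_power[OF cc] approx_const[of UNIV 0] by (cases "k < 0") simp_all
  qed (use gc in auto)
qed

section \<open>Laurent decomposition on the quadric \<open>hatZ\<close>\<close>

declare coord.simps [simp del] upd.simps [simp del]

text \<open>The function c(w) of the overview: the value of p0 q0 on \<open>hatZ\<close>, extended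
  to all pairs by a formula free of p0 and q0, so that overwriting these two coordinates leaves it
  unchanged.\<close>

definition cc :: "'n::finite cpair \<Rightarrow> complex" where
  "cc w = 1 + (\<Sum>i\<in>UNIV. coord (Inl (Some i)) w * coord (Inr (Some i)) w)"

abbreviation "p0 \<equiv> coord (Inl None)"
abbreviation "q0 \<equiv> coord (Inr None)"

lemma mem_hatZ_cc: "w \<in> hatZ \<longleftrightarrow> p0 w * q0 w = cc w"
  by (auto simp: mem_hatZ bform_def cc_def coord.simps algebra_simps)

lemma hatZ_cc: "w \<in> hatZ \<Longrightarrow> p0 w * q0 w = cc w"
  by (simp add: mem_hatZ_cc)

lemma cc_upd_None [simp]: "cc (upd (Inl None) z w) = cc w" "cc (upd (Inr None) z w) = cc w"
  by (simp_all add: cc_def coord_upd)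

lemma continuous_cc [continuous_intros]: "continuous_on X f \<Longrightarrow> continuous_on X (\<lambda>x. cc (f x))"
  unfolding cc_def by (intro continuous_intros)

lemma holomorphic_coord_upd: "(\<lambda>x. coord s (upd s' x w)) holomorphic_on A"
  by (cases "s = s'") (auto simp: coord_upd)

lemma holomorphic_cc_upd: "(\<lambda>x. cc (upd s x w)) holomorphic_on A"
  unfolding cc_def by (intro holomorphic_intros holomorphic_coord_upd)

lemma closed_hatZ: "closed (hatZ :: 'n::finite cpair set)"
proof -
  have "hatZ = {w :: 'n cpair. p0 w * q0 w = cc w}" by (auto simp: mem_hatZ_cc)
  moreover have "closed {w :: 'n cpair. p0 w * q0 w = cc w}"
    by (intro closed_Collect_eq continuous_intros)
  ultimately show ?thesis by simp
qed

definition setpq :: "complex \<Rightarrow> complex \<Rightarrow> 'n::finite cpair \<Rightarrow> 'n cpair" where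
  "setpq x y w = upd (Inl None) x (upd (Inr None) y w)"

lemma coord_setpq: "coord s (setpq x y w) = (if s = Inl None then x else if s = Inr None then y else coord s w)"
  by (simp add: setpq_def coord_upd)

lemma setpq_in_hatZ: "setpq x y w \<in> hatZ \<longleftrightarrow> x * y = cc w"
  by (simp add: mem_hatZ_cc coord_setpq) (simp add: setpq_def)

lemma continuous_setpq [continuous_intros]:
  "continuous_on X f \<Longrightarrow> continuous_on X g \<Longrightarrow> continuous_on X h \<Longrightarrow> continuous_on X (\<lambda>x. setpq (f x) (g x) (h x))"
  unfolding setpq_def by (intro continuous_intros)

lemma hcurve_setpq:
  assumes "f holomorphic_on S" "g holomorphic_on S" "hcurve S c"
  shows "hcurve S (\<lambda>t. setpq (f t) (g t) (c t))"
  unfolding hcurve_iff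
proof
  fix s
  show "(\<lambda>t. coord s (setpq (f t) (g t) (c t))) holomorphic_on S"
    using assms unfolding hcurve_iff coord_setpq by (cases "s = Inl None"; cases "s = Inr None") auto
qed

lemma hcurve_const: "hcurve S (\<lambda>_. w)" and hcurve_upd: "hcurve S (\<lambda>x. upd s x w)"
  unfolding hcurve_iff by (auto intro: holomorphic_coord_upd)

text \<open>The cofactors \<open>A k\<close> and \<open>A' k\<close> are entire on the ambient
  space, hence limits of polynomials by \<open>sep_approx\<close>; a power of \<open>p0\<close> or
  \<open>q0\<close> times a cofactor is the component of \<open>f\<close>.\<close>

lemma hatZ_approx:
  fixes f :: "'n::finite cpair \<Rightarrow> complex"
  assumes f: "holo_hatZ f"
  shows "approx hatZ f"
proof -
  have fc: "continuous_on hatZ f" by (rule holo_hatZ_continuous[OF f])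
  have open0: "open (-{0::complex})" by auto
  define R where "R = (\<lambda>z (w :: 'n cpair). setpq (z * p0 w) (q0 w / z) w)"
  \<comment> \<open>Overwriting \<open>p0\<close> and \<open>q0\<close> by \<open>z\<close> and
    \<open>cc w / z\<close> gives a point of \<open>hatZ\<close> for arbitrary \<open>w\<close>,
    also where \<open>p0\<close> vanishes. \<open>A'\<close> exchanges the roles, with
    \<open>q0\<close> replaced by \<open>1 / z\<close>.\<close>
  define A where "A = (\<lambda>k. \<lambda>w :: 'n cpair. lcoeff k (\<lambda>z. f (setpq z (cc w / z) w)))"
  define A' where "A' = (\<lambda>k. \<lambda>w :: 'n cpair. lcoeff k (\<lambda>z. f (setpq (z * cc w) (1 / z) w)))"
  have A: "approx hatZ (A k)" for k
  proof (rule approx_subset[OF sep_approx[of UNIV]])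
    show "sep_entire (A k)"
      unfolding A_def
    proof (rule sep_lcoeff)
      show "continuous_on ((- {0}) \<times> UNIV) (\<lambda>(z, w). f (setpq z (cc w / z) w))"
        unfolding case_prod_unfold
        by (rule continuous_on_compose2[OF fc]) (auto intro!: continuous_intros simp: setpq_in_hatZ split: if_splits)
      show "(\<lambda>x. f (setpq z (cc (upd s x w) / z) (upd s x w))) holomorphic_on UNIV" if "z \<noteq> 0" for z s w
        by (rule holo_hatZ_curve[OF f])
           (use that in \<open>auto intro!: hcurve_setpq hcurve_upd holomorphic_intros holomorphic_cc_upd simp: setpq_in_hatZ\<close>)
    qed
    show "A k w = A k w'" if "\<And>s. s \<in> UNIV \<Longrightarrow> coord s w = coord s w'" for w w'
      using coord_eqI[of w w'] that by simp
  qed auto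
  have A': "approx hatZ (A' k)" for k
  proof (rule approx_subset[OF sep_approx[of UNIV]])
    show "sep_entire (A' k)"
      unfolding A'_def
    proof (rule sep_lcoeff)
      show "continuous_on ((- {0}) \<times> UNIV) (\<lambda>(z, w). f (setpq (z * cc w) (1 / z) w))"
        unfolding case_prod_unfold
        by (rule continuous_on_compose2[OF fc]) (auto intro!: continuous_intros simp: setpq_in_hatZ split: if_splits)
      show "(\<lambda>x. f (setpq (z * cc (upd s x w)) (1 / z) (upd s x w))) holomorphic_on UNIV" if "z \<noteq> 0" for z s w
        by (rule holo_hatZ_curve[OF f])
           (use that in \<open>auto intro!: hcurve_setpq hcurve_upd holomorphic_intros holomorphic_cc_upd simp: setpq_in_hatZ\<close>)
    qed
    show "A' k w = A' k w'" if "\<And>s. s \<in> UNIV \<Longrightarrow> coord s w = coord s w'" for w w'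
      using coord_eqI[of w w'] that by simp
  qed auto
  show ?thesis
  proof (rule approx_fourier[where R = R, OF fc])
    show "R 1 w = w" for w by (rule coord_eqI) (auto simp: R_def coord_setpq)
    show "R z w \<in> hatZ" if "z \<noteq> 0" "w \<in> hatZ" for z w
      using that by (auto simp: R_def setpq_in_hatZ hatZ_cc)
    show "continuous_on ((- {0}) \<times> hatZ) (\<lambda>(z, w). R z w)"
      unfolding case_prod_unfold R_def by (intro continuous_intros) auto
    show "(\<lambda>z. f (R z w)) holomorphic_on - {0}" if "w \<in> hatZ" for w
      unfolding R_def
      by (rule holo_hatZ_curve[OF f])
         (use that in \<open>auto intro!: hcurve_setpq hcurve_const holomorphic_intros simp: setpq_in_hatZ hatZ_cc split: if_splits\<close>)
    fix k :: int
    \<comment> \<open>If \<open>p0 w\<close> is nonzero, \<open>R z w\<close> is the curve defining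
      \<open>A k\<close> taken at \<open>p0 w * z\<close>, so scaling produces the factor.\<close>
    have pos: "lcoeff k (\<lambda>z. f (R z w)) = p0 w ^ nat k * A k w" if w: "w \<in> hatZ" and k: "k \<ge> 0" for w
    proof (cases "p0 w = 0")
      case False
      have "R z w = setpq (p0 w * z) (cc w / (p0 w * z)) w" for z
        using w False by (simp add: R_def hatZ_cc[OF w, symmetric] mult.commute)
      moreover have hol: "(\<lambda>z. f (setpq z (cc w / z) w)) holomorphic_on -{0}"
        by (rule holo_hatZ_curve[OF f])
           (auto intro!: hcurve_setpq hcurve_const holomorphic_intros simp: setpq_in_hatZ split: if_splits)
      ultimately have "lcoeff k (\<lambda>z. f (R z w)) = p0 w powi k * A k w"
        unfolding A_def using lcoeff_scale[OF hol, of "p0 w" k] False by simp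
      then show ?thesis using k by (simp add: power_int_def)
    next
      case True
      \<comment> \<open>Here \<open>R z w\<close> depends only on \<open>1 / z\<close> and extends
        over \<open>1 / z = 0\<close>, so no positive power of \<open>z\<close> occurs. For
        \<open>k = 0\<close> both sides are the value of \<open>f\<close> at
        \<open>setpq 0 0 w\<close>.\<close>
      have c0: "cc w = 0" using w True by (simp add: mem_hatZ_cc)
      define e where "e = (\<lambda>y. f (setpq 0 (q0 w * y) w))"
      have e: "e holomorphic_on UNIV"
        unfolding e_def by (rule holo_hatZ_curve[OF f])
          (auto intro!: hcurve_setpq hcurve_const holomorphic_intros simp: setpq_in_hatZ c0)
      have e2: "(\<lambda>z. f (setpq z 0 w)) holomorphic_on UNIV"
        by (rule holo_hatZ_curve[OF f])
          (auto intro!: hcurve_setpq hcurve_const holomorphic_intros simp: setpq_in_hatZ c0)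
      have "lcoeff k (\<lambda>z. f (R z w)) = lcoeff k (\<lambda>z. e (1 / z))"
        by (simp add: R_def e_def True)
      also have "\<dots> = lcoeff (- k) e" by (rule lcoeff_inverse)
      also have "\<dots> = (if k = 0 then e 0 else 0)"
        using lcoeff_entire_neg[OF e, of "- k"] lcoeff_entire_0[OF e] k by auto
      also have "\<dots> = p0 w ^ nat k * A k w"
        using lcoeff_entire_0[OF e2] k by (auto simp: True A_def c0 e_def)
      finally show ?thesis .
    qed
    have neg: "lcoeff k (\<lambda>z. f (R z w)) = q0 w ^ nat (- k) * A' k w" if w: "w \<in> hatZ" and k: "k < 0" for w
    proof (cases "q0 w = 0")
      case False
      \<comment> \<open>The curve defining \<open>A' k\<close> at \<open>z / q0 w\<close>; for
        negative \<open>k\<close> the factor \<open>(1 / q0 w) powi k\<close> is a positive power of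
        \<open>q0 w\<close>.\<close>
      have "R z w = setpq ((1 / q0 w * z) * cc w) (1 / (1 / q0 w * z)) w" for z
        using w False by (simp add: R_def hatZ_cc[OF w, symmetric] mult.commute)
      moreover have hol: "(\<lambda>z. f (setpq (z * cc w) (1 / z) w)) holomorphic_on -{0}"
        by (rule holo_hatZ_curve[OF f])
           (auto intro!: hcurve_setpq hcurve_const holomorphic_intros simp: setpq_in_hatZ split: if_splits)
      ultimately have "lcoeff k (\<lambda>z. f (R z w)) = (1 / q0 w) powi k * A' k w"
        unfolding A'_def using lcoeff_scale[OF hol, of "1 / q0 w" k] False by simp
      then show ?thesis using k by (simp add: power_int_def)
    next
      case True
      have c0: "cc w = 0" using w True by (simp add: mem_hatZ_cc)
      \<comment> \<open>With \<open>q0 w = 0\<close> the curve is entire in \<open>z\<close> and has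
        no negative coefficients; the right-hand side vanishes because \<open>nat (- k)\<close> is
        positive.\<close>
      have e: "(\<lambda>z. f (setpq (z * p0 w) 0 w)) holomorphic_on UNIV"
        by (rule holo_hatZ_curve[OF f])
          (auto intro!: hcurve_setpq hcurve_const holomorphic_intros simp: setpq_in_hatZ c0)
      have "lcoeff k (\<lambda>z. f (R z w)) = 0"
        using lcoeff_entire_neg[OF e k] by (simp add: R_def True)
      then show ?thesis using k True by (simp add: power_0_left)
    qed
    show "approx hatZ (\<lambda>w. lcoeff k (\<lambda>z. f (R z w)))"
    proof (cases "k \<ge> 0")
      case True
      then show ?thesis using pos by (intro approx_cong[OF approx_coord_power[OF A]]) auto
    next
      case False
      then show ?thesis using neg by (intro approx_cong[OF approx_coord_power[OF A']]) auto
    qed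
  qed
qed

section \<open>The action of the nonzero scalars and averaging to weight zero\<close>

definition wact :: "complex \<Rightarrow> 'n::finite cpair \<Rightarrow> 'n cpair" where
  "wact z w = (z *s fst w, inverse z *s snd w)"

lemma bform_wact: "z \<noteq> 0 \<Longrightarrow> bform (wact z w) = bform w"
proof -
  assume "z \<noteq> 0"
  then have "z * a * (inverse z * b) = a * b" for a b by simp
  then show ?thesis unfolding bform_def wact_def by (simp only: fst_conv snd_conv vector_smult_component)
qed

lemma wact_hatZ: "z \<noteq> 0 \<Longrightarrow> wact z w \<in> hatZ \<longleftrightarrow> w \<in> hatZ"
  by (simp add: mem_hatZ bform_wact)

lemma norm_vector_smult: "norm (z *s v) = cmod z * norm (v :: complex ^ 'm::finite)"
  by (simp add: norm_vec_def norm_mult L2_set_right_distrib)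

lemma norm_wact: "cmod z = 1 \<Longrightarrow> norm (wact z w) = norm w"
  by (cases w) (simp add: wact_def norm_Pair norm_vector_smult norm_inverse)

text \<open>Polynomials fixed by \<open>wact\<close>. A monomial of equal degrees in p and q is a
  product of functions \<open>pqf i j\<close>, so a character is determined on it by its values
  there.\<close>

inductive weight_zero :: "('n::finite cpair \<Rightarrow> complex) \<Rightarrow> bool" where
  mon: "length is = length js \<Longrightarrow> weight_zero (pqmon is js)"
| add: "weight_zero f \<Longrightarrow> weight_zero g \<Longrightarrow> weight_zero (\<lambda>w. f w + g w)"
| scale: "weight_zero f \<Longrightarrow> weight_zero (\<lambda>w. c * f w)"

lemma pqmon_wact:
  assumes "z \<noteq> 0"
  shows "pqmon is js (wact z w) = z powi (int (length is) - int (length js)) * pqmon is js w"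
proof -
  have "prod_list (map (\<lambda>i. c * g i) xs) = c ^ length xs * prod_list (map g xs)" for c :: complex and g and xs :: "'a option list"
    by (induction xs) (auto simp: mult_ac)
  then show ?thesis
    using assms by (simp add: pqmon_def wact_def power_int_diff power_inverse divide_inverse mult_ac)
qed

lemma pqpoly_continuous: "pqpoly h \<Longrightarrow> continuous_on (-{0}) (\<lambda>z. h (wact z w))"
proof (induction rule: pqpoly.induct)
  case (mon "is" js)
  have "continuous_on (-{0}) (\<lambda>z. z powi (int (length is) - int (length js)) * pqmon is js w)"
    by (intro continuous_intros) auto
  then show ?case by (rule continuous_on_eq) (simp add: pqmon_wact)
qed (auto intro!: continuous_intros)

lemma lcoeff_add:
  assumes "continuous_on (-{0}) f" "continuous_on (-{0}) g"
  shows "lcoeff k (\<lambda>z. f z + g z) = lcoeff k f + lcoeff k g"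
  unfolding lcoeff_def distrib_right by (intro integral_add lcoeff_integrable assms)

lemma lcoeff_cmult: "lcoeff k (\<lambda>z. c * f z) = c * lcoeff k f"
  unfolding lcoeff_def by (simp add: mult.assoc)

text \<open>Under \<open>wact z\<close> a monomial of weight \<open>d\<close> acquires the factor
  \<open>z powi d\<close>, whose mean over the unit circle is 0 unless \<open>d = 0\<close>.\<close>

lemma pqpoly_average:
  "pqpoly h \<Longrightarrow> weight_zero (\<lambda>w. lcoeff 0 (\<lambda>z. h (wact z w)))"
proof (induction rule: pqpoly.induct)
  case (mon "is" js)
  define d where "d = int (length is) - int (length js)"
  have "lcoeff 0 (\<lambda>z. pqmon is js (wact z w)) = (if d = 0 then 1 else 0) * pqmon is js w" for w
  proof -
    have "lcoeff 0 (\<lambda>z. pqmon is js (wact z w)) = lcoeff (- d) (\<lambda>_. pqmon is js w)"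
      unfolding lcoeff_def by (simp add: pqmon_wact d_def mult.commute)
    then show ?thesis by (simp add: lcoeff_const)
  qed
  moreover have "weight_zero (\<lambda>w. (if d = 0 then 1 else 0) * pqmon is js w)"
  proof (cases "d = 0")
    case True
    then show ?thesis using weight_zero.mon[of "is" js] by (simp add: d_def)
  next
    case False
    then show ?thesis using weight_zero.scale[OF weight_zero.mon[of "[]" "[]"], of 0] by simp
  qed
  ultimately show ?case by simp
next
  case (add f g)
  then show ?case using weight_zero.add by (simp add: lcoeff_add pqpoly_continuous)
next
  case (scale f c)
  then show ?case using weight_zero.scale by (simp add: lcoeff_cmult)
qed

text \<open>A norm ball of \<open>hatZ\<close> is compact and stable under unit scalars. As
  \<open>f\<close> is its own average, averaging \<open>h\<close> does not increase the error;
  starting from \<open>e / 2\<close> keeps the final inequality strict.\<close>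

lemma invariant_approx:
  fixes f :: "'n::finite cpair \<Rightarrow> complex"
  assumes f: "holo_hatZ f" and inv: "\<And>z w. z \<noteq> 0 \<Longrightarrow> w \<in> hatZ \<Longrightarrow> f (wact z w) = f w" and e: "e > 0"
  obtains h where "weight_zero h" "\<And>w. w \<in> hatZ \<Longrightarrow> norm w \<le> r \<Longrightarrow> cmod (f w - h w) < e"
proof -
  have "compact (hatZ \<inter> cball 0 r)" by (simp add: closed_hatZ closed_Int_compact)
  then obtain h where h: "pqpoly h" "\<And>w. w \<in> hatZ \<inter> cball 0 r \<Longrightarrow> cmod (f w - h w) < e / 2"
    using approxE[OF hatZ_approx[OF f], of "hatZ \<inter> cball 0 r" "e / 2"] e by auto
  show ?thesis
  proof (rule that[OF pqpoly_average[OF h(1)]])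
    fix w :: "'n cpair" assume w: "w \<in> hatZ" "norm w \<le> r"
    have "f w - lcoeff 0 (\<lambda>z. h (wact z w)) = lcoeff 0 (\<lambda>z. f w + (- 1) * h (wact z w))"
      using pqpoly_continuous[OF h(1), of w]
      by (subst lcoeff_add) (auto intro!: continuous_intros simp: lcoeff_const lcoeff_cmult[of _ "- 1", simplified])
    moreover have "cmod (lcoeff 0 (\<lambda>z. f w + (- 1) * h (wact z w))) \<le> e / 2"
    proof (rule lcoeff_bound)
      show "continuous_on (- {0}) (\<lambda>z. f w + (- 1) * h (wact z w))"
        using pqpoly_continuous[OF h(1), of w] by (auto intro!: continuous_intros)
      fix z assume z: "cmod z = 1"
      then have "z \<noteq> 0" by auto
      then show "cmod (f w + (- 1) * h (wact z w)) \<le> e / 2"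
        using h(2)[of "wact z w"] inv[of z w] w z by (simp add: wact_hatZ norm_wact)
    qed
    ultimately show "cmod (f w - lcoeff 0 (\<lambda>z. h (wact z w))) < e" using e by simp
  qed
qed

subsection \<open>The identity theorem\<close>

lemma bform_add_left: "bform (p + p', q) = bform (p, q) + bform (p', q)"
  and bform_add_right: "bform (p, q + q') = bform (p, q) + bform (p, q')"
  and bform_smult_left: "bform (c *s p, q) = c * bform (p, q)"
  and bform_smult_right: "bform (p, c *s q) = c * bform (p, q)"
  by (simp_all add: bform_def algebra_simps sum.distrib sum_distrib_left)

lemma bform_vcnj: "bform (vcnj p, vcnj q) = cnj (bform (p, q))"
  and bform_commute: "bform (p, q) = bform (q, p)"
  by (simp_all add: bform_def vcnj_def mult.commute)

lemma vcnj_simps [simp]: "vcnj (vcnj p) = p" "vcnj (p + q) = vcnj p + vcnj q" "vcnj (c *s p) = cnj c *s vcnj p"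
  "vcnj p $ i = cnj (p $ i)"
  by (simp_all add: vcnj_def vec_eq_iff)

lemma continuous_vcnj [continuous_intros]: "continuous_on S f \<Longrightarrow> continuous_on S (\<lambda>x. vcnj (f x))"
  unfolding vcnj_def by (intro continuous_intros)

lemma continuous_bform [continuous_intros]: "continuous_on S f \<Longrightarrow> continuous_on S (\<lambda>x. bform (f x))"
  unfolding bform_def by (intro continuous_intros)

lemma continuous_smult [continuous_intros]:
  fixes g :: "'a::topological_space \<Rightarrow> complex ^ 'm::finite"
  shows "continuous_on S f \<Longrightarrow> continuous_on S g \<Longrightarrow> continuous_on S (\<lambda>x. f x *s g x)"
  unfolding vector_scalar_mult_def by (intro continuous_intros)

lemma Zset_bform: "r \<in> Zset \<longleftrightarrow> bform (r, vcnj r) = -1"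
proof -
  have "bform (r, vcnj r) = of_real (- (cmod (r $ None))\<^sup>2 + (\<Sum>i\<in>UNIV. (cmod (r $ Some i))\<^sup>2))"
    by (simp add: bform_def complex_norm_square[symmetric])
  then show ?thesis
    unfolding Zset_def by (metis (mono_tags, lifting) mem_Collect_eq of_real_1 of_real_eq_iff of_real_minus)
qed

lemma bform_self_real: "bform (r, vcnj r) = of_real (Re (bform (r, vcnj r)))"
proof -
  have "cnj (bform (r, vcnj r)) = bform (r, vcnj r)"
    using bform_vcnj[of r "vcnj r"] bform_commute[of "vcnj r" r] by simp
  then show ?thesis by (metis complex_is_Real_iff Reals_cnj_iff of_real_Re)
qed

text \<open>A retraction onto \<open>hatZ\<close> of the set where \<open>bform\<close> is nonzero:
  it brings lines of the ambient space back to \<open>hatZ\<close>.\<close>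

definition nrm :: "'n::finite cpair \<Rightarrow> 'n cpair" where
  "nrm w = (fst w, (- 1 / bform w) *s snd w)"

lemma nrm_hatZ: "bform w \<noteq> 0 \<Longrightarrow> nrm w \<in> hatZ"
  unfolding mem_hatZ nrm_def bform_smult_right by simp

lemma nrm_id: "w \<in> hatZ \<Longrightarrow> nrm w = w"
  by (simp add: mem_hatZ nrm_def)

definition pline :: "'n::finite cpair \<Rightarrow> 'n cpair \<Rightarrow> complex \<Rightarrow> 'n cpair" where
  "pline u v t = (fst u + t *s fst v, snd u + t *s snd v)"

lemma bform_pline:
  "bform (pline u v t) = bform u + t * (bform (fst u, snd v) + bform (fst v, snd u)) + t\<^sup>2 * bform v"
  by (simp add: pline_def bform_add_left bform_add_right bform_smult_left bform_smult_right algebra_simps power2_eq_square)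

lemma continuous_pline: "continuous_on S (pline u v)"
  unfolding pline_def by (intro continuous_intros)

text \<open>Along a line \<open>bform\<close> is a polynomial of degree at most 2, not identically
  zero because of \<open>x\<close>. Removing its finitely many roots leaves a connected open set of
  parameters, on which the identity theorem applies.\<close>

lemma pline_continuation:
  fixes f :: "'n::finite cpair \<Rightarrow> complex"
  assumes f: "holo_hatZ f" and x: "bform (pline u v x) \<noteq> 0" and t1: "bform (pline u v t1) \<noteq> 0"
    and lim: "t1 islimpt T" and T: "\<And>t. t \<in> T \<Longrightarrow> bform (pline u v t) \<noteq> 0 \<and> f (nrm (pline u v t)) = 0"
  shows "f (nrm (pline u v x)) = 0"
proof -
  define S where "S = {t. bform (pline u v t) \<noteq> 0}"
  have hb: "(\<lambda>t. bform (pline u v t)) holomorphic_on A" for A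
    unfolding bform_pline by (intro holomorphic_intros)
  have Sfin: "finite (- S)"
  proof -
    define P where "P = [:bform u, bform (fst u, snd v) + bform (fst v, snd u), bform v:]"
    have P: "poly P t = bform (pline u v t)" for t
      by (simp add: P_def bform_pline algebra_simps power2_eq_square)
    have "P \<noteq> 0" using x P[of x] by auto
    then show ?thesis using poly_roots_finite[of P] by (simp add: P S_def Compl_eq)
  qed
  have So: "open S" using Sfin finite_imp_closed[of "- S"] by (simp add: closed_def)
  have Sc: "connected S"
    using path_connected_complement_countable[of "- S"] Sfin
    by (simp add: countable_finite path_connected_imp_connected)
  show ?thesis
  proof (rule analytic_continuation[where S = S and U = T and \<xi> = t1 and f = "\<lambda>t. f (nrm (pline u v t))"])
    show "(\<lambda>t. f (nrm (pline u v t))) holomorphic_on S"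
    proof (rule holo_hatZ_curve[OF f So])
      show "hcurve S (\<lambda>t. nrm (pline u v t))"
        unfolding hcurve_def nrm_def
        by (auto intro!: holomorphic_intros hb simp: S_def) (auto simp: pline_def intro!: holomorphic_intros)
    qed (auto simp: S_def nrm_hatZ)
  qed (use So Sc x t1 lim T in \<open>auto simp: S_def\<close>)
qed

text \<open>On the chosen line real parameters give diagonal points and the parameter
  \<open>\<i>\<close> gives \<open>(p, q)\<close>. Hypothesis \<open>Q\<close> makes the Hermitian
  form negative at the midpoint of \<open>p\<close> and \<open>vcnj q\<close>, so for real
  parameters near 0 the points rescale into \<open>Zset\<close>.\<close>

lemma vanish_near_diagonal:
  fixes f :: "'n::finite cpair \<Rightarrow> complex"
  assumes f: "holo_hatZ f" and inv: "\<And>z w. z \<noteq> 0 \<Longrightarrow> w \<in> hatZ \<Longrightarrow> f (wact z w) = f w"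
    and diag: "\<And>r. r \<in> Zset \<Longrightarrow> f (r, vcnj r) = 0"
    and w: "(p, q) \<in> hatZ" and Q: "Re (bform (p, vcnj p)) + Re (bform (q, vcnj q)) < 2"
  shows "f (p, q) = 0"
proof -
  \<comment> \<open>\<open>r\<close> and \<open>s\<close> solve \<open>r + \<i> s = p\<close> and
    \<open>vcnj r + \<i> vcnj s = q\<close>.\<close>
  define r where "r = (1/2) *s (p + vcnj q)"
  define s where "s = (- \<i> / 2) *s (p + (- 1) *s vcnj q)"
  define u where "u = (r, vcnj r)"
  define v where "v = (s, vcnj s)"
  have Li: "pline u v \<i> = (p, q)"
    by (simp add: pline_def u_def v_def r_def s_def vec_eq_iff field_simps)
  have real_pt: "pline u v (of_real t) = (r + of_real t *s s, vcnj (r + of_real t *s s))" for t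
    by (simp add: pline_def u_def v_def)
  define g where "g t = Re (bform (pline u v (of_real t)))" for t :: real
  have gc: "continuous_on UNIV g"
    unfolding g_def by (intro continuous_intros continuous_on_compose2[OF continuous_pline]) auto
  have pq: "bform (p, q) = -1" using w by (simp add: mem_hatZ)
  \<comment> \<open>The two cross terms contribute -1 each: this is the origin of the bound 2 in
    \<open>Q\<close>.\<close>
  have "bform (vcnj q, vcnj p) = -1" using bform_vcnj[of q p] bform_commute[of q p] pq by simp
  then have br: "bform (r, vcnj r) = (bform (p, vcnj p) + bform (q, vcnj q) - 2) / 4"
    using pq bform_commute[of "vcnj q" q]
    by (simp add: r_def bform_add_left bform_add_right bform_smult_left bform_smult_right field_simps)
  have "Re (bform (r, vcnj r)) = (Re (bform (p, vcnj p)) + Re (bform (q, vcnj q)) - 2) / 4"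
    unfolding br by simp
  then have g0: "g 0 < 0" using Q by (simp add: g_def pline_def u_def v_def)
  \<comment> \<open>If the form at \<open>x\<close> is \<open>- (y * y)\<close>, then
    \<open>x / y\<close> lies in \<open>Zset\<close>, and acting with \<open>1 / y\<close> carries
    the normalised point to the diagonal point of \<open>x / y\<close>.\<close>
  have zero: "f (nrm (pline u v (of_real t))) = 0" if t: "g t < 0" for t
  proof -
    define x where "x = r + of_real t *s s"
    define y where "y = sqrt (- g t)"
    have y: "y > 0" "y * y = - g t" using t by (simp_all add: y_def)
    have L: "pline u v (of_real t) = (x, vcnj x)" using real_pt x_def by simp
    have b: "bform (x, vcnj x) = - of_real (y * y)"
      using bform_self_real[of x] y by (simp add: g_def L)
    define a where "a = complex_of_real (1 / y) *s x"
    have "bform (a, vcnj a) = -1"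
      using y(1) by (simp add: a_def bform_smult_left bform_smult_right b)
    then have "f (a, vcnj a) = 0" by (intro diag) (simp add: Zset_bform)
    moreover have "wact (of_real (1 / y)) (nrm (x, vcnj x)) = (a, vcnj a)"
      using y(1) by (simp add: wact_def nrm_def a_def b vec_eq_iff)
    moreover have "nrm (x, vcnj x) \<in> hatZ" using b y(1) by (intro nrm_hatZ) simp
    ultimately show ?thesis
      using inv[of "of_real (1 / y)" "nrm (x, vcnj x)"] y(1) L by simp
  qed
  have "open {t. g t < 0}" using gc by (intro open_Collect_less) (auto intro!: continuous_intros)
  then obtain d where d: "d > 0" "\<And>t. \<bar>t\<bar> < d \<Longrightarrow> g t < 0"
    using g0 unfolding open_dist dist_real_def by (metis (mono_tags, lifting) diff_zero mem_Collect_eq)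
  have "f (nrm (pline u v \<i>)) = 0"
  proof (rule pline_continuation[OF f, where T = "of_real ` {t. g t < 0}" and ?t1.0 = 0])
    show "bform (pline u v \<i>) \<noteq> 0" using Li pq by simp
    show "bform (pline u v 0) \<noteq> 0" using g0 by (auto simp: g_def)
    show "0 islimpt complex_of_real ` {t. g t < 0}"
      unfolding islimpt_approachable
    proof (intro allI impI)
      fix e :: real assume e: "e > 0"
      show "\<exists>x'\<in>complex_of_real ` {t. g t < 0}. x' \<noteq> 0 \<and> dist x' 0 < e"
        using d e by (intro bexI[of _ "of_real (min d e / 2)"] conjI imageI CollectI d(2)) (auto simp: min_def)
    qed
    show "bform (pline u v t) \<noteq> 0 \<and> f (nrm (pline u v t)) = 0" if "t \<in> of_real ` {t. g t < 0}" for t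
      using that zero by (auto simp: g_def)
  qed
  then show ?thesis using Li nrm_id[OF w] by simp
qed

text \<open>On the line from \<open>w\<close> at parameter 0 to \<open>(e0, e0)\<close> at parameter
  1, the sum bounded in \<open>vanish_near_diagonal\<close> is -2 at 1, hence below 2 nearby. The
  zeros found there propagate to parameter 0.\<close>

lemma vanish_of_diagonal:
  fixes f :: "'n::finite cpair \<Rightarrow> complex"
  assumes f: "holo_hatZ f" and inv: "\<And>z w. z \<noteq> 0 \<Longrightarrow> w \<in> hatZ \<Longrightarrow> f (wact z w) = f w"
    and diag: "\<And>r. r \<in> Zset \<Longrightarrow> f (r, vcnj r) = 0"
    and w: "w \<in> hatZ"
  shows "f w = 0"
proof -
  define e0 where "e0 = (axis None 1 :: 'n cvec)"
  define v where "v = (e0 + (- 1) *s fst w, e0 + (- 1) *s snd w)"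
  have L0: "pline w v 0 = w" and L1: "pline w v 1 = (e0, e0)"
    by (simp_all add: pline_def v_def vec_eq_iff)
  have be: "bform (e0, e0) = -1" by (simp add: bform_def e0_def axis_def)
  have ve: "vcnj e0 = e0" by (simp add: vcnj_def e0_def axis_def vec_eq_iff)
  define S where "S = {t. bform (pline w v t) \<noteq> 0}"
  define g where "g t = Re (bform (fst (nrm (pline w v t)), vcnj (fst (nrm (pline w v t)))))
      + Re (bform (snd (nrm (pline w v t)), vcnj (snd (nrm (pline w v t)))))" for t
  have So: "open S" unfolding S_def
    by (intro open_Collect_neq continuous_intros continuous_pline)
  have gc: "continuous_on S g"
    unfolding g_def nrm_def S_def by (intro continuous_intros continuous_pline) auto
  define T where "T = S \<inter> g -` {..<2}"
  have To: "open T" unfolding T_def by (rule continuous_open_preimage[OF gc So]) simp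
  have "1 \<in> T" by (simp add: T_def S_def g_def L1 be nrm_def ve)
  then have "1 islimpt T" using To by (simp add: interior_limit_point interior_open)
  then have "f (nrm (pline w v 0)) = 0"
  proof (rule pline_continuation[OF f, rotated 2])
    show "bform (pline w v t) \<noteq> 0 \<and> f (nrm (pline w v t)) = 0" if "t \<in> T" for t
    proof
      show b: "bform (pline w v t) \<noteq> 0" using that by (simp add: T_def S_def)
      have "f (fst (nrm (pline w v t)), snd (nrm (pline w v t))) = 0"
        using nrm_hatZ[OF b] that by (intro vanish_near_diagonal[OF f inv diag]) (auto simp: T_def g_def)
      then show "f (nrm (pline w v t)) = 0" by simp
    qed
  qed (use w L0 L1 be in \<open>auto simp: mem_hatZ\<close>)
  then show ?thesis using L0 nrm_id[OF w] by simp
qed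

subsection \<open>Orbits and holomorphic extensions\<close>

definition orb :: "'n::finite cpair \<Rightarrow> 'n cpair set" where
  "orb w = corb (fst w) (snd w)"

lemma mem_orb: "v \<in> orb w \<longleftrightarrow> (\<exists>z. z \<noteq> 0 \<and> v = wact z w)"
  by (auto simp: orb_def corb_def wact_def)

lemma wact_wact: "wact a (wact b w) = wact (a * b) w"
  by (simp add: wact_def vector_smult_assoc mult.commute)

lemma wact_1 [simp]: "wact 1 w = w"
  by (simp add: wact_def)

lemma orb_self: "w \<in> orb w"
  unfolding mem_orb by (rule exI[of _ 1]) simp

lemma orb_wact:
  assumes z: "z \<noteq> 0" shows "orb (wact z w) = orb w"
proof (intro set_eqI iffI)
  fix v assume "v \<in> orb (wact z w)"
  then obtain a where "a \<noteq> 0" "v = wact (a * z) w" by (auto simp: mem_orb wact_wact)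
  then show "v \<in> orb w" using z unfolding mem_orb by (intro exI[of _ "a * z"]) simp
next
  fix v assume "v \<in> orb w"
  then obtain a where "a \<noteq> 0" "v = wact a w" by (auto simp: mem_orb)
  then show "v \<in> orb (wact z w)"
    using z unfolding mem_orb by (intro exI[of _ "a / z"]) (simp add: wact_wact)
qed

lemma orb_eqI: "v \<in> orb w \<Longrightarrow> orb v = orb w"
  by (auto simp: mem_orb orb_wact)

lemma hatD_orb: "hatD = orb ` hatZ"
  by (auto simp: hatD_def orb_def case_prod_unfold)

lemma orb_subset_hatZ: "w \<in> hatZ \<Longrightarrow> orb w \<subseteq> hatZ"
  by (auto simp: mem_orb wact_hatZ)

lemma hatD_eq_orb: "x \<in> hatD \<Longrightarrow> w \<in> x \<Longrightarrow> w \<in> hatZ \<and> x = orb w"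
proof -
  assume "x \<in> hatD" "w \<in> x"
  then obtain v where v: "v \<in> hatZ" "x = orb v" "w \<in> orb v" by (auto simp: hatD_orb)
  then show ?thesis using orb_subset_hatZ[of v] orb_eqI[of w v] by auto
qed

text \<open>Sets of orbits correspond to saturated subsets of \<open>hatZ\<close>; this lets the
  quotient topology be handled upstairs.\<close>

lemma Union_mem_iff: "U \<subseteq> hatD \<Longrightarrow> w \<in> \<Union>U \<longleftrightarrow> w \<in> hatZ \<and> orb w \<in> U"
proof
  assume U: "U \<subseteq> hatD" and "w \<in> \<Union>U"
  then obtain x where x: "x \<in> U" "w \<in> x" by (elim UnionE)
  then show "w \<in> hatZ \<and> orb w \<in> U" using hatD_eq_orb[of x w] U by auto
next
  assume "w \<in> hatZ \<and> orb w \<in> U"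
  then show "w \<in> \<Union>U" using orb_self[of w] by (intro UnionI[of "orb w"]) simp_all
qed

lemma holo_hatD_orb: "holo_hatD F \<longleftrightarrow> holo_hatZ (\<lambda>w. F (orb w))"
  by (simp add: holo_hatD_def orb_def case_prod_unfold)

definition holinv :: "('n::finite cpair \<Rightarrow> complex) \<Rightarrow> bool" where
  "holinv f \<longleftrightarrow> holo_hatZ f \<and> (\<forall>z w. z \<noteq> 0 \<longrightarrow> w \<in> hatZ \<longrightarrow> f (wact z w) = f w)"

lemma holinv_orb: "holo_hatD F \<Longrightarrow> holinv (\<lambda>w. F (orb w))"
  by (simp add: holinv_def holo_hatD_orb orb_wact)

lemma holinv_on_orb:
  assumes "holinv f" "w \<in> hatZ" "v \<in> orb w" shows "f v = f w"
proof -
  obtain z where "z \<noteq> 0" "v = wact z w" using assms(3) unfolding mem_orb by (elim exE conjE)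
  then show ?thesis using assms(1,2) unfolding holinv_def by (simp del: split_paired_All)
qed

lemma holinv_some_orb:
  assumes "holinv f" "w \<in> hatZ" shows "f (SOME v. v \<in> orb w) = f w"
  by (rule holinv_on_orb[OF assms], rule someI[of _ w]) (rule orb_self)

lemma holinv_const: "holinv (\<lambda>_. c)"
  and holinv_add: "holinv f \<Longrightarrow> holinv g \<Longrightarrow> holinv (\<lambda>w. f w + g w)"
  and holinv_mult: "holinv f \<Longrightarrow> holinv g \<Longrightarrow> holinv (\<lambda>w. f w * g w)"
  by (simp_all add: holinv_def holo_hatZ_const holo_hatZ_add holo_hatZ_mult)

lemma holinv_sum: "finite A \<Longrightarrow> (\<And>i. i \<in> A \<Longrightarrow> holinv (f i)) \<Longrightarrow> holinv (\<lambda>w. \<Sum>i\<in>A. f i w)"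
  by (induction A rule: finite_induct) (simp_all add: holinv_const holinv_add)

lemma holinv_pqmon: "length is = length js \<Longrightarrow> holinv (pqmon is js)"
  by (simp add: holinv_def holo_hatZ_pqmon pqmon_wact)

lemma holinv_weight_zero: "weight_zero h \<Longrightarrow> holinv h"
  by (induction rule: weight_zero.induct) (simp_all add: holinv_pqmon holinv_add holinv_mult holinv_const)

lemma Zset_diag: "r \<in> Zset \<Longrightarrow> (r, vcnj r) \<in> hatZ"
  by (simp add: Zset_bform mem_hatZ)

text \<open>\<open>DeltaD\<close> is a union over all representatives. For a unit scalar
  \<open>inverse z = cnj z\<close>, so changing the representative amounts to a \<open>wact\<close>,
  and all these orbits coincide.\<close>

lemma DnE:
  assumes "x \<in> Dn" "r \<in> x"
  shows "r \<in> Zset" "DeltaD x = orb (r, vcnj r)"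
proof -
  obtain r0 where r0: "r0 \<in> Zset" "x = u1orb r0" using assms by (auto simp: Dn_def)
  have d: "(z *s r0, vcnj (z *s r0)) = wact z (r0, vcnj r0)" if "cmod z = 1" for z
  proof -
    have "z * cnj z = 1" using that by (simp add: complex_norm_square[symmetric])
    then have "inverse z = cnj z" by (metis inverse_unique)
    then show ?thesis by (simp add: wact_def)
  qed
  have o: "orb (s, vcnj s) = orb (r0, vcnj r0)" if s: "s \<in> x" for s
  proof -
    obtain z where z: "cmod z = 1" "s = z *s r0" using s r0 by (auto simp: u1orb_def)
    then have "z \<noteq> 0" by auto
    then show ?thesis using d[OF z(1)] orb_wact z(2) by metis
  qed
  obtain z where z: "cmod z = 1" "r = z *s r0" using assms r0 by (auto simp: u1orb_def)
  then have "z \<noteq> 0" by auto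
  then have "(r, vcnj r) \<in> hatZ"
    unfolding z(2) d[OF z(1)] by (simp add: wact_hatZ Zset_diag r0(1))
  then show "r \<in> Zset" by (simp add: Zset_bform mem_hatZ)
  have "DeltaD x = (\<Union>s\<in>x. orb (s, vcnj s))" by (simp add: DeltaD_def orb_def)
  also have "\<dots> = (\<Union>s\<in>x. orb (r, vcnj r))" using o o[OF assms(2)] by (intro SUP_cong) simp_all
  also have "\<dots> = orb (r, vcnj r)" using assms(2) by auto
  finally show "DeltaD x = orb (r, vcnj r)" .
qed

lemma u1orb_self: "r \<in> u1orb r"
  unfolding u1orb_def by (rule CollectI, rule exI[of _ 1]) simp

lemma Dn_nonempty: "x \<in> Dn \<Longrightarrow> \<exists>r. r \<in> x"
  using u1orb_self by (auto simp: Dn_def)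

lemma DeltaD_hatD: "x \<in> Dn \<Longrightarrow> DeltaD x \<in> hatD"
proof -
  assume x: "x \<in> Dn"
  then obtain r where "r \<in> x" using Dn_nonempty by auto
  then show ?thesis using DnE[OF x, of r] Zset_diag[of r] unfolding hatD_orb by simp
qed

lemma DeltaD_u1orb: "r \<in> Zset \<Longrightarrow> u1orb r \<in> Dn \<and> DeltaD (u1orb r) = orb (r, vcnj r)"
  using DnE(2)[OF _ u1orb_self] by (auto simp: Dn_def)

section \<open>Holomorphic extensions and the algebra \<open>AD\<close>\<close>

definition is_ext :: "('n::finite cvec set \<Rightarrow> complex) \<Rightarrow> ('n cpair set \<Rightarrow> complex) \<Rightarrow> bool" where
  "is_ext a F \<longleftrightarrow> holo_hatD F \<and> (\<forall>x\<in>Dn. a x = F (DeltaD x))"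

text \<open>The difference lifts to an invariant holomorphic function vanishing on the diagonal, so
  \<open>vanish_of_diagonal\<close> applies.\<close>

lemma is_ext_unique:
  fixes F G :: "'n::finite cpair set \<Rightarrow> complex"
  assumes "is_ext a F" "is_ext a G" "x \<in> hatD"
  shows "F x = G x"
proof -
  obtain w where w: "w \<in> hatZ" "x = orb w" using assms by (auto simp: hatD_orb)
  have h: "holinv (\<lambda>w. F (orb w) + (- 1) * G (orb w))"
    using assms by (intro holinv_add holinv_mult holinv_const holinv_orb) (auto simp: is_ext_def)
  have "F (orb w) + (- 1) * G (orb w) = 0"
  proof (rule vanish_of_diagonal[where f = "\<lambda>w. F (orb w) + (- 1) * G (orb w)", OF _ _ _ w(1)])
    fix r :: "'n cvec" assume "r \<in> Zset"
    then show "F (orb (r, vcnj r)) + (- 1) * G (orb (r, vcnj r)) = 0"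
      using assms(1,2) DeltaD_u1orb[of r] by (auto simp: is_ext_def dest!: bspec[of Dn _ "u1orb r"])
  qed (use h in \<open>auto simp: holinv_def\<close>)
  then show ?thesis using w by simp
qed

lemma is_ext_restrict: "is_ext a F \<Longrightarrow> is_ext a (restrict F hatD)"
proof -
  have "holo_hatZ (\<lambda>w. restrict F hatD (orb w)) \<longleftrightarrow> holo_hatZ (\<lambda>w. F (orb w))"
    by (rule holo_hatZ_cong) (auto simp: hatD_orb)
  then show "is_ext a F \<Longrightarrow> is_ext a (restrict F hatD)"
    by (simp add: is_ext_def holo_hatD_orb DeltaD_hatD)
qed

lemma hatA_eq:
  assumes "is_ext a F" shows "hatA a = restrict F hatD"
  unfolding hatA_def
proof (rule the_equality)
  show "restrict F hatD \<in> extensional hatD \<and> holo_hatD (restrict F hatD) \<and> (\<forall>x\<in>Dn. a x = restrict F hatD (DeltaD x))"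
    using is_ext_restrict[OF assms] by (auto simp: is_ext_def)
  fix G assume G: "G \<in> extensional hatD \<and> holo_hatD G \<and> (\<forall>x\<in>Dn. a x = G (DeltaD x))"
  then have "is_ext a G" by (simp add: is_ext_def)
  then show "G = restrict F hatD"
    using is_ext_unique[OF _ assms] G by (auto simp: extensional_def restrict_def fun_eq_iff)
qed

lemma AD_iff: "a \<in> AD \<longleftrightarrow> (\<exists>F. is_ext a F) \<and> (\<forall>x. x \<notin> Dn \<longrightarrow> a x = 0)"
proof
  assume "a \<in> AD"
  then show "(\<exists>F. is_ext a F) \<and> (\<forall>x. x \<notin> Dn \<longrightarrow> a x = 0)"
    by (auto simp: AD_def is_ext_def)
next
  assume r: "(\<exists>F. is_ext a F) \<and> (\<forall>x. x \<notin> Dn \<longrightarrow> a x = 0)"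
  then obtain F where "is_ext a F" by blast
  then show "a \<in> AD" using r unfolding AD_def is_ext_def
    by (intro CollectI exI[of _ F]) (auto simp: fun_eq_iff)
qed

lemma is_ext_hatA: "a \<in> AD \<Longrightarrow> is_ext a (hatA a)"
  using hatA_eq is_ext_restrict by (metis AD_iff)

lemma hatA_x: "is_ext a F \<Longrightarrow> x \<in> hatD \<Longrightarrow> hatA a x = F x"
  by (simp add: hatA_eq)

lemma is_ext_add: "is_ext a F \<Longrightarrow> is_ext b G \<Longrightarrow> is_ext (\<lambda>x. a x + b x) (\<lambda>x. F x + G x)"
  and is_ext_mult: "is_ext a F \<Longrightarrow> is_ext b G \<Longrightarrow> is_ext (\<lambda>x. a x * b x) (\<lambda>x. F x * G x)"
  and is_ext_cmult: "is_ext a F \<Longrightarrow> is_ext (\<lambda>x. c * a x) (\<lambda>x. c * F x)"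
  by (simp_all add: is_ext_def holo_hatD_orb holo_hatZ_add holo_hatZ_mult holo_hatZ_const)

lemma AD_add: "a \<in> AD \<Longrightarrow> b \<in> AD \<Longrightarrow> (\<lambda>x. a x + b x) \<in> AD"
  and AD_mult: "a \<in> AD \<Longrightarrow> b \<in> AD \<Longrightarrow> (\<lambda>x. a x * b x) \<in> AD"
  and AD_cmult: "a \<in> AD \<Longrightarrow> (\<lambda>x. c * a x) \<in> AD"
  unfolding AD_iff by (auto intro: is_ext_add is_ext_mult is_ext_cmult)

lemma hatA_add: "a \<in> AD \<Longrightarrow> b \<in> AD \<Longrightarrow> x \<in> hatD \<Longrightarrow> hatA (\<lambda>x. a x + b x) x = hatA a x + hatA b x"
  and hatA_mult: "a \<in> AD \<Longrightarrow> b \<in> AD \<Longrightarrow> x \<in> hatD \<Longrightarrow> hatA (\<lambda>x. a x * b x) x = hatA a x * hatA b x"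
  and hatA_cmult: "a \<in> AD \<Longrightarrow> x \<in> hatD \<Longrightarrow> hatA (\<lambda>x. c * a x) x = c * hatA a x"
  by (rule hatA_x[OF is_ext_add[OF is_ext_hatA is_ext_hatA]], assumption+)
     (rule hatA_x[OF is_ext_mult[OF is_ext_hatA is_ext_hatA]] hatA_x[OF is_ext_cmult[OF is_ext_hatA]], assumption+)+

lemma hatA_diff: "a \<in> AD \<Longrightarrow> b \<in> AD \<Longrightarrow> x \<in> hatD \<Longrightarrow> hatA (\<lambda>x. a x - b x) x = hatA a x - hatA b x"
  using hatA_add[OF _ AD_cmult[of b "- 1"], of a x] hatA_cmult[of b x "- 1"] by simp

lemma holinv_hatA: "a \<in> AD \<Longrightarrow> holinv (\<lambda>w. hatA a (orb w))"
  using is_ext_hatA by (intro holinv_orb) (auto simp: is_ext_def)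

text \<open>The element of \<open>AD\<close> whose holomorphic extension lifts to the invariant function \<open>f\<close> on \<open>hatZ\<close>.\<close>
definition elt :: "('n::finite cpair \<Rightarrow> complex) \<Rightarrow> 'n cvec set \<Rightarrow> complex" where
  "elt f x = (if x \<in> Dn then (let r = (SOME r. r \<in> x) in f (r, vcnj r)) else 0)"

text \<open>Both arbitrary choices are harmless: \<open>f\<close> is constant on orbits, and every
  representative of \<open>x\<close> gives a diagonal point lying in
  \<open>DeltaD x\<close>.\<close>

lemma is_ext_elt:
  assumes "holinv f" shows "is_ext (elt f) (\<lambda>x. f (SOME w. w \<in> x))"
proof -
  note f = holinv_some_orb[OF assms]
  have "holo_hatZ (\<lambda>w. f (SOME v. v \<in> orb w)) \<longleftrightarrow> holo_hatZ f"
    by (rule holo_hatZ_cong) (rule f)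
  moreover have "elt f x = f (SOME w. w \<in> DeltaD x)" if x: "x \<in> Dn" for x
  proof -
    define r where "r = (SOME r. r \<in> x)"
    have r: "r \<in> x" unfolding r_def using Dn_nonempty[OF x] by (rule someI_ex)
    then show ?thesis
      using x f[OF Zset_diag] DnE[OF x r] by (simp add: elt_def r_def[symmetric])
  qed
  ultimately show ?thesis using assms by (simp add: is_ext_def holo_hatD_orb holinv_def)
qed

lemma elt_AD: "holinv f \<Longrightarrow> elt f \<in> AD"
  using is_ext_elt by (auto simp: AD_iff elt_def)

lemma hatA_elt:
  assumes "holinv f" "w \<in> hatZ" shows "hatA (elt f) (orb w) = f w"
  using hatA_x[OF is_ext_elt[OF assms(1)]] assms by (simp add: hatD_orb holinv_some_orb)

lemma elt_add: "elt (\<lambda>w. f w + g w) = (\<lambda>x. elt f x + elt g x)"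
  and elt_mult: "elt (\<lambda>w. f w * g w) = (\<lambda>x. elt f x * elt g x)"
  and elt_cmult: "elt (\<lambda>w. c * f w) = (\<lambda>x. c * elt f x)"
  and elt_one: "elt (\<lambda>w. 1) = unitA"
  by (auto simp: elt_def unitA_def fun_eq_iff Let_def)

lemma elt_cong: "(\<And>w. w \<in> hatZ \<Longrightarrow> f w = g w) \<Longrightarrow> elt f = elt g"
proof (rule ext)
  fix x :: "'a cvec set"
  assume fg: "\<And>w. w \<in> hatZ \<Longrightarrow> f w = g w"
  show "elt f x = elt g x"
  proof (cases "x \<in> Dn")
    case True
    have "(SOME r. r \<in> x) \<in> x" using Dn_nonempty[OF True] by (rule someI_ex)
    from fg[OF Zset_diag[OF DnE(1)[OF True this]]] show ?thesis by (simp add: elt_def)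
  qed (simp add: elt_def)
qed

lemma unitA_AD: "unitA \<in> AD" and hatA_unitA: "x \<in> hatD \<Longrightarrow> hatA unitA x = 1"
  using elt_AD[OF holinv_const[of 1]] hatA_elt[OF holinv_const[of 1]] by (auto simp: elt_one hatD_orb)

definition pqf :: "'n option \<Rightarrow> 'n option \<Rightarrow> 'n::finite cpair \<Rightarrow> complex" where
  "pqf i j w = fst w $ i * snd w $ j"

lemma holinv_pqf: "holinv (pqf i j)"
proof -
  have "pqf i j = pqmon [i] [j]" by (auto simp: fun_eq_iff pqf_def pqmon_def)
  then show ?thesis by (simp add: holinv_pqmon)
qed

subsection \<open>Topologies\<close>

lemma openin_hatD_top:
  fixes U :: "'n::finite cpair set set"
  shows "openin hatD_top U \<longleftrightarrow> U \<subseteq> hatD \<and> openin (top_of_set hatZ) (\<Union>U)"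
proof -
  have "istopology (\<lambda>U. U \<subseteq> hatD \<and> openin (top_of_set hatZ) (\<Union>U :: 'n cpair set))"
    unfolding istopology_def
  proof (intro conjI allI impI)
    fix S T :: "'n cpair set set"
    assume S: "S \<subseteq> hatD \<and> openin (top_of_set hatZ) (\<Union>S)" and T: "T \<subseteq> hatD \<and> openin (top_of_set hatZ) (\<Union>T)"
    then have ST: "S \<inter> T \<subseteq> hatD" by auto
    \<comment> \<open>Distinct orbits are disjoint, so taking the union of orbits commutes with this
      intersection.\<close>
    have "\<Union>(S \<inter> T) = \<Union>S \<inter> \<Union>T"
      using Union_mem_iff[OF ST] Union_mem_iff[of S] Union_mem_iff[of T] S T
      by (intro set_eqI) (auto simp del: Union_iff)
    moreover have "openin (top_of_set hatZ) (\<Union>S \<inter> \<Union>T)"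
      by (rule openin_Int[OF conjunct2[OF S] conjunct2[OF T]])
    ultimately show "openin (top_of_set hatZ) (\<Union>(S \<inter> T))" by (simp only:)
    show "S \<inter> T \<subseteq> hatD" by (rule ST)
  next
    fix \<K> :: "'n cpair set set set"
    assume K: "\<forall>K\<in>\<K>. K \<subseteq> hatD \<and> openin (top_of_set hatZ) (\<Union>K)"
    then show "\<Union>\<K> \<subseteq> hatD" by (intro Union_least) simp
    have "openin (top_of_set hatZ) (\<Union>(Union ` \<K>))"
      by (rule openin_Union) (use K in auto)
    moreover have "\<Union>(\<Union>\<K>) = \<Union>(Union ` \<K>)" by auto
    ultimately show "openin (top_of_set hatZ) (\<Union>(\<Union>\<K>))" by (simp only:)
  qed
  then show ?thesis unfolding hatD_top_def by (simp add: topology_inverse')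
qed

lemma topspace_hatD_top [simp]: "topspace hatD_top = (hatD :: 'n::finite cpair set set)"
proof -
  have "\<Union>hatD = (hatZ :: 'n cpair set)"
    using Union_mem_iff[of hatD] by (intro set_eqI) (auto simp: hatD_orb simp del: Union_iff)
  then have "openin hatD_top (hatD :: 'n cpair set set)" unfolding openin_hatD_top by (metis openin_subtopology_self subset_refl)
  then have "(hatD :: 'n cpair set set) \<subseteq> topspace hatD_top" by (rule openin_subset)
  moreover have "topspace hatD_top \<subseteq> (hatD :: 'n cpair set set)"
    using openin_topspace[of "hatD_top :: 'n cpair set topology"] unfolding openin_hatD_top by simp
  ultimately show ?thesis by simp
qed

lemma continuous_wact_right: "continuous_on S (wact z)"
  unfolding wact_def by (intro continuous_intros)

text \<open>The images of the open norm balls are an increasing open cover of \<open>hatD\<close>.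
  The bound allows finitely many seminorms of \<open>AD\<close> to be controlled on one ball
  upstairs.\<close>

lemma compactin_hatD_bounded:
  fixes K :: "'n::finite cpair set set"
  assumes "compactin hatD_top K"
  obtains r where "\<And>x. x \<in> K \<Longrightarrow> \<exists>w\<in>hatZ. norm w \<le> r \<and> x = orb w"
proof -
  define V :: "nat \<Rightarrow> 'n cpair set set" where "V n = orb ` {w \<in> hatZ. norm w < real n}" for n
  have V: "openin hatD_top (V n)" for n
    unfolding openin_hatD_top
  proof
    show "V n \<subseteq> hatD" by (auto simp: V_def hatD_orb)
    \<comment> \<open>The saturation of a ball is a union of preimages under the continuous maps
      \<open>wact z\<close>, hence open.\<close>
    have "\<Union>(V n) = (\<Union>z\<in>-{0}. hatZ \<inter> wact z -` {w. norm w < real n})"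
    proof (intro set_eqI iffI)
      fix v :: "'n cpair" assume "v \<in> \<Union>(V n)"
      then obtain w z where w: "w \<in> hatZ" "norm w < real n" "z \<noteq> 0" "v = wact z w"
        by (auto simp: V_def mem_orb)
      then have "wact (inverse z) v = w" by (simp add: wact_wact)
      then show "v \<in> (\<Union>z\<in>-{0}. hatZ \<inter> wact z -` {w. norm w < real n})"
        using w by (intro UN_I[of "inverse z"]) (simp_all add: wact_hatZ)
    next
      fix v :: "'n cpair" assume "v \<in> (\<Union>z\<in>-{0}. hatZ \<inter> wact z -` {w. norm w < real n})"
      then obtain z where z: "z \<noteq> 0" "v \<in> hatZ" "norm (wact z v) < real n" by auto
      then have "orb v \<in> V n" unfolding V_def
        by (intro image_eqI[of _ _ "wact z v"]) (simp_all add: orb_wact wact_hatZ)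
      then show "v \<in> \<Union>(V n)" using orb_self by (intro UnionI)
    qed
    also have "openin (top_of_set hatZ) \<dots>"
    proof (rule openin_Union, elim imageE, simp only:)
      fix z :: complex
      have "open {w :: 'n cpair. norm w < real n}" by (intro open_Collect_less continuous_intros)
      then show "openin (top_of_set hatZ) (hatZ \<inter> wact z -` {w :: 'n cpair. norm w < real n})"
        by (rule continuous_openin_preimage_gen[OF continuous_wact_right])
    qed
    finally show "openin (top_of_set hatZ) (\<Union>(V n))" .
  qed
  have "K \<subseteq> \<Union>(range V)"
  proof
    fix x assume "x \<in> K"
    then have "x \<in> hatD" using assms by (auto simp: compactin_def)
    then obtain w where "w \<in> hatZ" "x = orb w" by (auto simp: hatD_orb)
    moreover obtain n where "norm w < real n" using reals_Archimedean2 by auto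
    ultimately show "x \<in> \<Union>(range V)" by (intro UnionI[of "V n"]) (simp_all add: V_def)
  qed
  then obtain \<F> where F: "finite \<F>" "\<F> \<subseteq> range V" "K \<subseteq> \<Union>\<F>"
    using assms V unfolding compactin_def by (metis (mono_tags, lifting) imageE)
  then obtain N where N: "finite N" "\<F> = V ` N" by (meson finite_subset_image)
  show thesis
  proof (rule that[of "real (Max (insert 0 N))"])
    fix x assume "x \<in> K"
    then obtain n where n: "n \<in> N" "x \<in> V n" using F N by auto
    then obtain w where "w \<in> hatZ" "norm w < real n" "x = orb w" by (auto simp: V_def)
    moreover have "n \<le> Max (insert 0 N)" using N n by (intro Max_ge) auto
    ultimately show "\<exists>w\<in>hatZ. norm w \<le> real (Max (insert 0 N)) \<and> x = orb w"
      by (intro bexI[of _ w]) auto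
  qed
qed

lemma continuous_map_hatA:
  assumes "a \<in> AD" shows "continuous_map hatD_top euclidean (hatA a)"
  unfolding continuous_map
proof (intro conjI allI impI)
  fix V :: "complex set" assume "openin euclidean V"
  then have V: "open V" by simp
  have c: "continuous_on hatZ (\<lambda>w. hatA a (orb w))"
    using holinv_hatA[OF assms] by (intro holo_hatZ_continuous) (simp add: holinv_def)
  have s: "{x \<in> topspace hatD_top. hatA a x \<in> V} \<subseteq> hatD" by auto
  have "\<Union>{x \<in> topspace hatD_top. hatA a x \<in> V} = hatZ \<inter> (\<lambda>w. hatA a (orb w)) -` V"
    using Union_mem_iff[OF s] by (intro set_eqI) (auto simp: hatD_orb simp del: Union_iff)
  then show "openin hatD_top {x \<in> topspace hatD_top. hatA a x \<in> V}"
    unfolding openin_hatD_top using s continuous_openin_preimage_gen[OF c V] by simp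
qed simp

definition AD_open :: "('n::finite cvec set \<Rightarrow> complex) set \<Rightarrow> bool" where
  "AD_open U \<longleftrightarrow> U \<subseteq> AD \<and> (\<forall>a\<in>U. \<exists>Ks \<epsilon>. finite Ks \<and> (\<forall>K\<in>Ks. compactin hatD_top K) \<and>
      \<epsilon> > 0 \<and> {b \<in> AD. \<forall>K\<in>Ks. snorm K (\<lambda>x. b x - a x) < \<epsilon>} \<subseteq> U)"

lemma openin_AD_top:
  fixes U :: "('n::finite cvec set \<Rightarrow> complex) set"
  shows "openin AD_top U \<longleftrightarrow> AD_open U"
proof -
  have "istopology (AD_open :: ('n cvec set \<Rightarrow> complex) set \<Rightarrow> bool)"
    unfolding istopology_def
  proof (intro conjI allI impI)
    fix S T :: "('n cvec set \<Rightarrow> complex) set" assume S: "AD_open S" and T: "AD_open T"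
    show "AD_open (S \<inter> T)"
      unfolding AD_open_def
    proof (intro conjI ballI)
      fix a assume a: "a \<in> S \<inter> T"
      obtain Ks e where 1: "finite Ks" "\<forall>K\<in>Ks. compactin hatD_top K" "e > 0"
        "{b \<in> AD. \<forall>K\<in>Ks. snorm K (\<lambda>x. b x - a x) < e} \<subseteq> S"
        using S a unfolding AD_open_def by (auto 0 3)
      obtain Ks' e' where 2: "finite Ks'" "\<forall>K\<in>Ks'. compactin hatD_top K" "e' > 0"
        "{b \<in> AD. \<forall>K\<in>Ks'. snorm K (\<lambda>x. b x - a x) < e'} \<subseteq> T"
        using T a unfolding AD_open_def by (auto 0 3)
      show "\<exists>Ks \<epsilon>. finite Ks \<and> (\<forall>K\<in>Ks. compactin hatD_top K) \<and>
          \<epsilon> > 0 \<and> {b \<in> AD. \<forall>K\<in>Ks. snorm K (\<lambda>x. b x - a x) < \<epsilon>} \<subseteq> S \<inter> T"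
        using 1 2 by (intro exI[of _ "Ks \<union> Ks'"] exI[of _ "min e e'"]) (auto simp: subset_iff)
    qed (use S in \<open>auto simp: AD_open_def\<close>)
  next
    fix \<K> :: "('n cvec set \<Rightarrow> complex) set set" assume K: "\<forall>K\<in>\<K>. AD_open K"
    show "AD_open (\<Union>\<K>)"
      unfolding AD_open_def
    proof (intro conjI ballI)
      show "\<Union>\<K> \<subseteq> AD" using K by (intro Union_least) (simp add: AD_open_def)
      fix a assume "a \<in> \<Union>\<K>"
      then obtain S where S: "a \<in> S" "S \<in> \<K>" by auto
      then obtain Ks e where "finite Ks" "\<forall>K\<in>Ks. compactin hatD_top K" "e > 0"
        "{b \<in> AD. \<forall>K\<in>Ks. snorm K (\<lambda>x. b x - a x) < e} \<subseteq> S"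
        using K unfolding AD_open_def by (auto 0 3)
      then show "\<exists>Ks \<epsilon>. finite Ks \<and> (\<forall>K\<in>Ks. compactin hatD_top K) \<and>
          \<epsilon> > 0 \<and> {b \<in> AD. \<forall>K\<in>Ks. snorm K (\<lambda>x. b x - a x) < \<epsilon>} \<subseteq> \<Union>\<K>"
        using S(2) by (intro exI[of _ Ks] exI[of _ e]) auto
    qed
  qed
  then show ?thesis unfolding AD_top_def AD_open_def by (simp add: topology_inverse')
qed

lemma topspace_AD_top [simp]: "topspace AD_top = AD"
proof -
  have "openin AD_top AD"
    unfolding openin_AD_top AD_open_def by (auto intro!: exI[of _ "{}"] exI[of _ "1::real"])
  moreover have "openin AD_top (topspace AD_top)" by simp
  ultimately show ?thesis
    using openin_subset by (metis AD_open_def openin_AD_top subset_antisym)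
qed

lemma snorm_singleton: "snorm {x} a = cmod (hatA a x)"
  by (simp add: snorm_def sup_max[symmetric] cSup_insert) (simp add: sup_max)

text \<open>Points are compact, so continuity comes from the seminorm of \<open>{x}\<close>; the
  algebraic laws come from uniqueness of extensions.\<close>

lemma delta_Spec:
  assumes x: "x \<in> hatD" shows "delta x \<in> Spec"
proof -
  have "continuous_map AD_top euclidean (delta x)"
    unfolding continuous_map
  proof (intro conjI allI impI)
    fix V :: "complex set" assume "openin euclidean V"
    then have V: "open V" by simp
    show "openin AD_top {a \<in> topspace AD_top. delta x a \<in> V}"
      unfolding openin_AD_top AD_open_def
    proof (intro conjI ballI)
      fix a assume "a \<in> {a \<in> topspace AD_top. delta x a \<in> V}"
      then have a: "a \<in> AD" "hatA a x \<in> V" by (auto simp: delta_def)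
      then obtain e where e: "e > 0" "ball (hatA a x) e \<subseteq> V" using V open_contains_ball by metis
      have "delta x b \<in> V" if b: "b \<in> AD" "snorm {x} (\<lambda>x. b x - a x) < e" for b
      proof -
        have "cmod (hatA b x - hatA a x) < e" using b a x by (simp add: snorm_singleton hatA_diff)
        then have "hatA b x \<in> ball (hatA a x) e" by (simp add: dist_norm norm_minus_commute)
        then show ?thesis using e(2) b by (auto simp: delta_def)
      qed
      then show "\<exists>Ks \<epsilon>. finite Ks \<and> (\<forall>K\<in>Ks. compactin hatD_top K) \<and>
          \<epsilon> > 0 \<and> {b \<in> AD. \<forall>K\<in>Ks. snorm K (\<lambda>x. b x - a x) < \<epsilon>} \<subseteq> {a \<in> topspace AD_top. delta x a \<in> V}"
        using e(1) x by (intro exI[of _ "{{x}}"] exI[of _ e]) (auto simp: finite_imp_compactin)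
    qed auto
  qed simp
  then show ?thesis
    using x by (simp add: Spec_def delta_def AD_add AD_mult AD_cmult unitA_AD hatA_add hatA_mult hatA_cmult hatA_unitA)
qed

subsection \<open>Continuous characters\<close>

lemma Spec_elt:
  assumes "\<phi> \<in> Spec"
  shows Spec_elt_add: "holinv f \<Longrightarrow> holinv g \<Longrightarrow> \<phi> (elt (\<lambda>w. f w + g w)) = \<phi> (elt f) + \<phi> (elt g)"
    and Spec_elt_mult: "holinv f \<Longrightarrow> holinv g \<Longrightarrow> \<phi> (elt (\<lambda>w. f w * g w)) = \<phi> (elt f) * \<phi> (elt g)"
    and Spec_elt_cmult: "holinv f \<Longrightarrow> \<phi> (elt (\<lambda>w. c * f w)) = c * \<phi> (elt f)"
    and Spec_elt_const: "\<phi> (elt (\<lambda>w. c)) = c"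
proof -
  show cm: "holinv f \<Longrightarrow> \<phi> (elt (\<lambda>w. c * f w)) = c * \<phi> (elt f)" for f c
    using assms unfolding elt_cmult by (simp add: Spec_def elt_AD)
  show "\<phi> (elt (\<lambda>w. c)) = c"
    using cm[OF holinv_const[of 1], of c] assms by (simp add: elt_one Spec_def)
qed (use assms in \<open>simp_all add: elt_add elt_mult Spec_def elt_AD\<close>)

lemma Spec_elt_sum:
  assumes "\<phi> \<in> Spec" "finite A" "\<And>i. i \<in> A \<Longrightarrow> holinv (f i)"
  shows "\<phi> (elt (\<lambda>w. \<Sum>i\<in>A. f i w)) = (\<Sum>i\<in>A. \<phi> (elt (f i)))"
  using assms(2,3)
  by (induction A rule: finite_induct)
     (simp_all add: Spec_elt_const[OF assms(1)] Spec_elt_add[OF assms(1)] holinv_sum)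

text \<open>Recovers a representative \<open>(p, q)\<close> of a point from the values of \<open>p\<^sup>j q\<^sup>k\<close>, provided \<open>p\<^sup>i q\<^sup>i \<noteq> 0\<close>.\<close>
definition sect :: "'n option \<Rightarrow> (('n::finite cvec set \<Rightarrow> complex) \<Rightarrow> complex) \<Rightarrow> 'n cpair" where
  "sect i \<phi> = ((\<chi> j. \<phi> (elt (pqf j i))), (\<chi> j. \<phi> (elt (pqf i j)) / \<phi> (elt (pqf i i))))"

lemma Spec_sect:
  fixes \<phi> :: "('n::finite cvec set \<Rightarrow> complex) \<Rightarrow> complex"
  assumes \<phi>: "\<phi> \<in> Spec"
  obtains i where "\<phi> (elt (pqf i i)) \<noteq> 0" "sect i \<phi> \<in> hatZ" "\<And>j k. \<phi> (elt (pqf j k)) = pqf j k (sect i \<phi>)"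
proof -
  define M where "M j k = \<phi> (elt (pqf j k))" for j k
  \<comment> \<open>Both products are values of the character on one and the same function, with
    factors \<open>p_i\<close>, \<open>p_k\<close>, \<open>q_j\<close>, \<open>q_l\<close>.\<close>
  have rank: "M i j * M k l = M i l * M k j" for i j k l
  proof -
    have "(\<lambda>w. pqf i j w * pqf k l w) = (\<lambda>w. pqf i l w * pqf k j w)"
      by (auto simp: pqf_def fun_eq_iff)
    then show ?thesis
      unfolding M_def by (metis Spec_elt_mult[OF \<phi> holinv_pqf holinv_pqf])
  qed
  \<comment> \<open>The defining equation of \<open>hatZ\<close>, read as an identity between
    elements of \<open>AD\<close>. It rules out that all diagonal entries vanish.\<close>
  have trace: "- M None None + (\<Sum>i\<in>UNIV. M (Some i) (Some i)) = - 1"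
  proof -
    have "elt (\<lambda>w :: 'n cpair. (- 1) * pqf None None w + (\<Sum>i\<in>UNIV. pqf (Some i) (Some i) w)) = elt (\<lambda>_. - 1)"
      by (rule elt_cong) (auto simp: mem_hatZ bform_def pqf_def)
    moreover have "\<phi> (elt (\<lambda>w :: 'n cpair. (- 1) * pqf None None w + (\<Sum>i\<in>UNIV. pqf (Some i) (Some i) w)))
       = - M None None + (\<Sum>i\<in>UNIV. M (Some i) (Some i))"
      unfolding M_def
      by (subst Spec_elt_add[OF \<phi>], intro holinv_mult holinv_const holinv_pqf, intro holinv_sum holinv_pqf finite,
          subst Spec_elt_cmult[OF \<phi> holinv_pqf], subst Spec_elt_sum[OF \<phi>]) (simp_all add: holinv_pqf)
    ultimately show ?thesis using Spec_elt_const[OF \<phi>, of "- 1"] by simp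
  qed
  obtain i where i: "M i i \<noteq> 0"
  proof (rule ccontr)
    assume "\<not> thesis"
    then have "M i i = 0" for i using that by blast
    then show False using trace by simp
  qed
  \<comment> \<open>The minor relation \<open>M j i * M i k = M j k * M i i\<close>, solved for
    \<open>M j k\<close>.\<close>
  have eq: "M j k = pqf j k (sect i \<phi>)" for j k
    using i rank[of j i i k] by (simp add: pqf_def sect_def M_def[symmetric] field_simps)
  show thesis
  proof (rule that[of i])
    show "sect i \<phi> \<in> hatZ" using trace unfolding eq by (simp add: mem_hatZ bform_def pqf_def)
  qed (use i eq in \<open>auto simp: M_def\<close>)
qed

text \<open>The section gives \<open>w\<close> moved by the scalar \<open>snd w $ i\<close>, that
  is, the representative of the orbit whose \<open>i\<close>-th q-coordinate is 1.\<close>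

lemma sect_delta:
  assumes w: "w \<in> hatZ" and i: "delta (orb w) (elt (pqf i i)) \<noteq> 0"
  shows "sect i (delta (orb w)) \<in> orb w"
proof -
  have d: "delta (orb w) (elt (pqf j k)) = fst w $ j * snd w $ k" for j k
    using hatA_elt[OF holinv_pqf w] by (simp add: delta_def elt_AD holinv_pqf pqf_def)
  have "snd w $ i \<noteq> 0" "fst w $ i \<noteq> 0" using i unfolding d by auto
  moreover have "sect i (delta (orb w)) = wact (snd w $ i) w"
    using calculation unfolding sect_def d by (simp add: wact_def vec_eq_iff field_simps)
  ultimately show ?thesis unfolding mem_orb by (intro exI[of _ "snd w $ i"]) simp
qed

lemma delta_inj: "inj_on delta (hatD :: 'n::finite cpair set set)"
proof (rule inj_onI)
  fix x y :: "'n cpair set" assume x: "x \<in> hatD" and y: "y \<in> hatD" and e: "delta x = delta y"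
  obtain v w where v: "v \<in> hatZ" "x = orb v" and w: "w \<in> hatZ" "y = orb w" using x y by (auto simp: hatD_orb)
  obtain i where i: "delta x (elt (pqf i i)) \<noteq> 0" using Spec_sect[OF delta_Spec[OF x]] by metis
  have "sect i (delta x) \<in> orb v" "sect i (delta x) \<in> orb w"
    using sect_delta[OF v(1)] sect_delta[OF w(1)] i e v w by auto
  then show "x = y" using orb_eqI v w by metis
qed

lemma snorm_le:
  assumes "\<And>x. x \<in> K \<Longrightarrow> cmod (hatA a x) \<le> B" "0 \<le> B" shows "snorm K a \<le> B"
  unfolding snorm_def using assms by (intro cSup_least) auto

text \<open>Index lists of equal length pair off into factors \<open>pqf i j\<close>, whose values
  are prescribed by \<open>M\<close>.\<close>

lemma Spec_weight_zero:
  fixes \<phi> :: "('n::finite cvec set \<Rightarrow> complex) \<Rightarrow> complex"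
  assumes \<phi>: "\<phi> \<in> Spec" and M: "\<And>j k. \<phi> (elt (pqf j k)) = pqf j k w0" and h: "weight_zero h"
  shows "\<phi> (elt h) = h w0"
  using h
proof (induction rule: weight_zero.induct)
  case (mon "is" js)
  then show ?case
  proof (induction "is" js rule: list_induct2)
    case Nil
    have "pqmon [] [] = (\<lambda>_ :: 'n cpair. 1)" by (auto simp: pqmon_def)
    then show ?case using Spec_elt_const[OF \<phi>, of 1] by simp
  next
    case (Cons i "is" j js)
    have e: "pqmon (i # is) (j # js) = (\<lambda>w. pqf i j w * pqmon is js w)"
      by (auto simp: pqmon_def pqf_def)
    show ?case
      unfolding e using Cons by (simp add: Spec_elt_mult[OF \<phi>] holinv_pqf holinv_pqmon M)
  qed
next
  case (add f g)
  then show ?case by (simp add: Spec_elt_add[OF \<phi>] holinv_weight_zero)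
next
  case (scale f c)
  then show ?case by (simp add: Spec_elt_cmult[OF \<phi>] holinv_weight_zero)
qed

text \<open>Continuity at 0: a neighbourhood of 0 mapped into the unit disc is cut out by finitely
  many seminorms, and their compact sets lift to a single norm ball.\<close>

lemma Spec_bounded:
  fixes \<phi> :: "('n::finite cvec set \<Rightarrow> complex) \<Rightarrow> complex"
  assumes \<phi>: "\<phi> \<in> Spec"
  shows "\<exists>r. \<exists>e>0. \<forall>b\<in>AD. (\<forall>w\<in>hatZ. norm w \<le> r \<longrightarrow> cmod (hatA b (orb w)) \<le> e) \<longrightarrow> cmod (\<phi> b) < 1"
proof -
  define z0 :: "'n cvec set \<Rightarrow> complex" where "z0 = (\<lambda>_. 0)"
  have z0: "z0 = elt (\<lambda>_. 0)" by (auto simp: z0_def elt_def)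
  have "continuous_map AD_top euclidean \<phi>" using \<phi> by (simp add: Spec_def)
  then have "openin AD_top {a \<in> topspace AD_top. \<phi> a \<in> ball 0 1}"
    by (rule openin_continuous_map_preimage) simp
  then have "AD_open {a \<in> AD. \<phi> a \<in> ball 0 1}" by (simp add: openin_AD_top)
  moreover have "z0 \<in> {a \<in> AD. \<phi> a \<in> ball 0 1}"
    using Spec_elt_const[OF \<phi>, of 0] by (simp add: z0 elt_AD holinv_const)
  ultimately obtain Ks e where Ks: "finite Ks" "\<forall>K\<in>Ks. compactin hatD_top K" and e: "e > 0"
    and sub: "{b \<in> AD. \<forall>K\<in>Ks. snorm K (\<lambda>x. b x - z0 x) < e} \<subseteq> {a \<in> AD. \<phi> a \<in> ball 0 1}"
    unfolding AD_open_def by (auto 0 3)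
  have "\<forall>K\<in>Ks. \<exists>r. \<forall>x\<in>K. \<exists>w\<in>hatZ. norm w \<le> r \<and> x = orb w"
    using Ks(2) compactin_hatD_bounded by metis
  then obtain R where R: "\<And>K x. K \<in> Ks \<Longrightarrow> x \<in> K \<Longrightarrow> \<exists>w\<in>hatZ. norm w \<le> R K \<and> x = orb w"
    by metis
  define r where "r = Max (insert 0 (R ` Ks))"
  have r: "R K \<le> r" if "K \<in> Ks" for K unfolding r_def using Ks(1) that by (intro Max_ge) auto
  show ?thesis
  \<comment> \<open>A pointwise bound gives only a weak bound on the supremum, so
    \<open>e / 2\<close> is used to get below \<open>e\<close>.\<close>
  proof (rule exI[of _ r], rule exI[of _ "e / 2"], intro conjI ballI impI)
    fix b :: "'n cvec set \<Rightarrow> complex"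
    assume b: "b \<in> AD" and B: "\<forall>w\<in>hatZ. norm w \<le> r \<longrightarrow> cmod (hatA b (orb w)) \<le> e / 2"
    have "snorm K (\<lambda>x. b x - z0 x) < e" if K: "K \<in> Ks" for K
    proof -
      have "cmod (hatA b x) \<le> e / 2" if x: "x \<in> K" for x
      proof -
        obtain w where w: "w \<in> hatZ" "norm w \<le> R K" "x = orb w" using R[OF K x] by (elim bexE conjE)
        then show ?thesis using bspec[OF B w(1)] r[OF K] by simp
      qed
      then have "snorm K b \<le> e / 2" using e by (intro snorm_le) auto
      then show ?thesis using e by (simp add: z0_def)
    qed
    then have "b \<in> {a \<in> AD. \<phi> a \<in> ball 0 1}" using sub b by (intro subsetD[OF sub]) simp
    then show "cmod (\<phi> b) < 1" by simp
  qed (use e in simp)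
qed

text \<open>If \<open>h\<close> has weight zero and is close to \<open>a\<close> on a large ball,
  then \<open>\<phi> a\<close> and the value of \<open>hatA a\<close> at \<open>orb w0\<close> are
  both close to \<open>h w0\<close>.\<close>

lemma Spec_is_delta:
  fixes \<phi> :: "('n::finite cvec set \<Rightarrow> complex) \<Rightarrow> complex"
  assumes \<phi>: "\<phi> \<in> Spec" shows "\<exists>x\<in>hatD. \<phi> = delta x"
proof -
  obtain w0 :: "'n cpair" where w0: "w0 \<in> hatZ" and M: "\<And>j k. \<phi> (elt (pqf j k)) = pqf j k w0"
    using Spec_sect[OF \<phi>] by metis
  obtain r0 e where e: "e > 0"
    and bd: "\<forall>b\<in>AD. (\<forall>w\<in>hatZ. norm w \<le> r0 \<longrightarrow> cmod (hatA b (orb w)) \<le> e) \<longrightarrow> cmod (\<phi> b) < 1"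
    using Spec_bounded[OF \<phi>] by (elim exE conjE)
  have lin: "\<And>a b. a \<in> AD \<Longrightarrow> b \<in> AD \<Longrightarrow> \<phi> (\<lambda>x. a x + b x) = \<phi> a + \<phi> b"
    "\<And>c a. a \<in> AD \<Longrightarrow> \<phi> (\<lambda>x. c * a x) = c * \<phi> a"
    using \<phi> by (auto simp: Spec_def)
  have main: "\<phi> a = hatA a (orb w0)" if a: "a \<in> AD" for a
  proof (rule ccontr)
    assume ne: "\<phi> a \<noteq> hatA a (orb w0)"
    \<comment> \<open>Half the supposed gap. Tolerance \<open>e * m\<close> puts
      \<open>(a - elt h) / m\<close> within the reach of \<open>bd\<close>, tolerance
      \<open>m\<close> controls the value at \<open>w0\<close>, and the radius is large enough to
      include \<open>w0\<close>.\<close>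
    define m where "m = cmod (\<phi> a - hatA a (orb w0)) / 2"
    have m: "m > 0" using ne by (simp add: m_def)
    have "min (e * m) m > 0" using e m by simp
    then obtain h where h: "weight_zero h"
      "\<And>w. w \<in> hatZ \<Longrightarrow> norm w \<le> max r0 (norm w0) \<Longrightarrow> cmod (hatA a (orb w) - h w) < min (e * m) m"
      using invariant_approx[of "\<lambda>w. hatA a (orb w)" "min (e * m) m" "max r0 (norm w0)"] holinv_hatA[OF a]
      unfolding holinv_def by metis
    define b where "b = (\<lambda>x. of_real (1 / m) * (a x + (- 1) * elt h x))"
    have hA: "elt h \<in> AD" by (rule elt_AD[OF holinv_weight_zero[OF h(1)]])
    have c: "(\<lambda>x. a x + (- 1) * elt h x) \<in> AD" by (rule AD_add[OF a AD_cmult[OF hA]])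
    have b: "b \<in> AD" unfolding b_def by (rule AD_cmult[OF c])
    have "cmod (\<phi> b) < 1"
    proof (rule mp[OF bspec[OF bd b]], intro ballI impI)
      fix w :: "'n cpair" assume w: "w \<in> hatZ" "norm w \<le> r0"
      then have x: "orb w \<in> hatD" by (simp add: hatD_orb)
      have "hatA b (orb w) = of_real (1 / m) * (hatA a (orb w) - h w)"
        unfolding b_def using x w hA a
        by (simp only: hatA_cmult[OF c x] hatA_add[OF a AD_cmult[OF hA] x] hatA_cmult[OF hA x] hatA_elt[OF holinv_weight_zero[OF h(1)] w(1)]) simp
      then have "cmod (hatA b (orb w)) = cmod (hatA a (orb w) - h w) / m"
        using m by (simp add: norm_divide)
      also have "\<dots> \<le> e"
        using h(2)[OF w(1) max.coboundedI1[OF w(2)]] m by (simp add: field_simps)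
      finally show "cmod (hatA b (orb w)) \<le> e" .
    qed
    moreover have "\<phi> b = of_real (1 / m) * (\<phi> a - h w0)"
      unfolding b_def
      by (simp only: lin(2)[OF c] lin(1)[OF a AD_cmult[OF hA]] lin(2)[OF hA] Spec_weight_zero[OF \<phi> M h(1)]) simp
    ultimately have "cmod (\<phi> a - h w0) < m" using m by (simp add: norm_divide)
    moreover have "cmod (hatA a (orb w0) - h w0) < m" using h(2)[OF w0] by simp
    ultimately have "cmod (\<phi> a - hatA a (orb w0)) < m + m"
      using norm_diff_triangle_less[of "\<phi> a" "h w0" m "hatA a (orb w0)" m] by (simp add: norm_minus_commute)
    then show False by (simp add: m_def)
  qed
  have "\<phi> = delta (orb w0)"
  proof
    fix a show "\<phi> a = delta (orb w0) a"
      using main \<phi> by (cases "a \<in> AD") (auto simp: delta_def Spec_def extensional_def)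
  qed
  then show ?thesis using w0 by (auto simp: hatD_orb)
qed

lemma delta_image: "delta ` hatD = Spec"
  using delta_Spec Spec_is_delta by auto

section \<open>The homeomorphism onto the spectrum\<close>

lemma topspace_weak_star: "topspace weak_star = extensional AD"
  by (simp add: weak_star_def PiE_def)

lemma continuous_map_vec_lambda:
  fixes f :: "'a \<Rightarrow> 'm::finite \<Rightarrow> 'b::topological_space"
  assumes "\<And>i. continuous_map X euclidean (\<lambda>x. f x i)"
  shows "continuous_map X euclidean (\<lambda>x. \<chi> i. f x i)"
  using assms unfolding continuous_map_atin
  by (auto intro!: tendsto_vec_lambda)

text \<open>Each \<open>sect i\<close> provides a continuous inverse on the weak-star open set where
  \<open>\<phi> (elt (pqf i i))\<close> is nonzero, and these sets cover \<open>Spec\<close>. Only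
  the finitely many values collected in \<open>\<Psi>\<close> are involved.\<close>

lemma delta_open:
  fixes U :: "'n::finite cpair set set"
  assumes U: "openin hatD_top U"
  shows "openin (subtopology weak_star Spec) (delta ` U)"
proof -
  have UD: "U \<subseteq> hatD" and "openin (top_of_set hatZ) (\<Union>U)" using U by (auto simp: openin_hatD_top)
  then obtain O' where O': "open O'" "\<Union>U = hatZ \<inter> O'" by (auto simp: openin_open)
  define \<Psi> :: "(('n cvec set \<Rightarrow> complex) \<Rightarrow> complex) \<Rightarrow> complex ^ 'n option ^ 'n option"
    where "\<Psi> \<phi> = (\<chi> j k. \<phi> (elt (pqf j k)))" for \<phi>
  have \<Psi>: "continuous_map weak_star euclidean \<Psi>"
    unfolding \<Psi>_def weak_star_def
    by (intro continuous_map_vec_lambda continuous_map_product_projection elt_AD holinv_pqf)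
  define s :: "'n option \<Rightarrow> complex ^ 'n option ^ 'n option \<Rightarrow> 'n cpair"
    where "s i M = ((\<chi> j. M $ j $ i), (\<chi> j. M $ i $ j / M $ i $ i))" for i M
  have ss: "sect i \<phi> = s i (\<Psi> \<phi>)" for i \<phi> by (simp add: sect_def s_def \<Psi>_def)
  \<comment> \<open>The matrices whose reconstructed point lies in \<open>O'\<close>, the ambient
    open set cutting out the preimage of \<open>U\<close> in \<open>hatZ\<close>.\<close>
  define W where "W i = {M. M $ i $ i \<noteq> 0} \<inter> s i -` O'" for i
  have W: "open (W i)" for i
    unfolding W_def
  proof (rule continuous_open_preimage[OF _ _ O'(1)])
    show "continuous_on {M. M $ i $ i \<noteq> 0} (s i)"
      unfolding s_def by (intro continuous_intros) auto
    show "open {M :: complex ^ 'n option ^ 'n option. M $ i $ i \<noteq> 0}"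
      by (intro open_Collect_neq continuous_intros)
  qed
  have "openin weak_star {\<phi> \<in> topspace weak_star. \<Psi> \<phi> \<in> (\<Union>i. W i)}"
    using W by (intro openin_continuous_map_preimage[OF \<Psi>]) auto
  moreover have "delta ` U = {\<phi> \<in> topspace weak_star. \<Psi> \<phi> \<in> (\<Union>i. W i)} \<inter> Spec"
  proof (intro set_eqI iffI)
    fix \<phi> assume "\<phi> \<in> delta ` U"
    then obtain x where x: "x \<in> U" "\<phi> = delta x" by auto
    then have xD: "x \<in> hatD" using UD by auto
    then obtain w where w: "w \<in> hatZ" "x = orb w" by (auto simp: hatD_orb)
    have \<phi>: "\<phi> \<in> Spec" using x delta_Spec[OF xD] by simp
    obtain i where i: "\<phi> (elt (pqf i i)) \<noteq> 0" using Spec_sect[OF \<phi>] by metis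
    have "sect i \<phi> \<in> x" using sect_delta[OF w(1)] i x w by simp
    then have "s i (\<Psi> \<phi>) \<in> O'" using O'(2) x(1) ss[of i \<phi>] by auto
    then have "\<Psi> \<phi> \<in> W i" using i by (simp add: W_def \<Psi>_def)
    then show "\<phi> \<in> {\<phi> \<in> topspace weak_star. \<Psi> \<phi> \<in> (\<Union>i. W i)} \<inter> Spec"
      using \<phi> by (auto simp: topspace_weak_star Spec_def)
  next
    fix \<phi> assume "\<phi> \<in> {\<phi> \<in> topspace weak_star. \<Psi> \<phi> \<in> (\<Union>i. W i)} \<inter> Spec"
    then obtain i where \<phi>: "\<phi> \<in> Spec" and i: "\<Psi> \<phi> \<in> W i" by auto
    obtain x where x: "x \<in> hatD" "\<phi> = delta x" using Spec_is_delta[OF \<phi>] by auto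
    then obtain w where w: "w \<in> hatZ" "x = orb w" by (auto simp: hatD_orb)
    have "sect i \<phi> \<in> orb w" using i x w by (simp add: W_def \<Psi>_def sect_delta[OF w(1)])
    moreover have "sect i \<phi> \<in> O'" using i by (simp add: W_def ss)
    ultimately have "sect i \<phi> \<in> \<Union>U" using O'(2) orb_subset_hatZ[OF w(1)] by auto
    then have "orb (sect i \<phi>) \<in> U" using Union_mem_iff[OF UD] by auto
    moreover have "orb (sect i \<phi>) = x" using orb_eqI[OF \<open>sect i \<phi> \<in> orb w\<close>] w by simp
    ultimately show "\<phi> \<in> delta ` U" using x by auto
  qed
  ultimately show ?thesis by (auto simp: openin_subtopology)
qed

lemma delta_homeomorphic: "homeomorphic_map hatD_top (subtopology weak_star Spec) delta"
proof (rule bijective_open_imp_homeomorphic_map)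
  have ex: "delta x \<in> extensional AD" for x by (simp add: delta_def)
  have "continuous_map hatD_top weak_star delta"
    unfolding weak_star_def continuous_map_componentwise
  proof (intro conjI ballI)
    fix a assume a: "a \<in> AD"
    then have "(\<lambda>x. delta x a) = hatA a" by (auto simp: delta_def)
    then show "continuous_map hatD_top euclidean (\<lambda>x. delta x a)" using continuous_map_hatA[OF a] by simp
  qed (use ex in auto)
  then show "continuous_map hatD_top (subtopology weak_star Spec) delta"
    using delta_Spec by (auto simp: continuous_map_in_subtopology)
  show "open_map hatD_top (subtopology weak_star Spec) delta"
    unfolding open_map_def using delta_open by auto
  show "delta ` topspace hatD_top = topspace (subtopology weak_star Spec)"
    by (auto simp: delta_image topspace_weak_star Spec_def)
  show "inj_on delta (topspace hatD_top)" by (simp add: delta_inj)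
qed

section \<open>The involution \<open>tau\<close> and the star-characters\<close>

definition tau_lift :: "'n::finite cpair \<Rightarrow> 'n cpair" where
  "tau_lift w = (vcnj (snd w), vcnj (fst w))"

lemma tau_lift_hatZ: "w \<in> hatZ \<Longrightarrow> tau_lift w \<in> hatZ"
  using bform_vcnj[of "snd w" "fst w"] bform_commute[of "snd w" "fst w"] by (simp add: tau_lift_def mem_hatZ)

lemma tau_lift_wact: "z \<noteq> 0 \<Longrightarrow> tau_lift (wact z w) = wact (inverse (cnj z)) (tau_lift w)"
  by (simp add: tau_lift_def wact_def)

lemma tau_orb: "tau (orb w) = orb (tau_lift w)"
proof -
  have "tau (orb w) = tau_lift ` orb w" by (force simp: tau_def tau_lift_def)
  also have "\<dots> = orb (tau_lift w)"
  proof (intro set_eqI iffI)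
    fix v assume "v \<in> tau_lift ` orb w"
    then obtain z where "z \<noteq> 0" "v = wact (inverse (cnj z)) (tau_lift w)" by (auto simp: mem_orb tau_lift_wact)
    then show "v \<in> orb (tau_lift w)" unfolding mem_orb by (intro exI[of _ "inverse (cnj z)"]) simp
  next
    fix v assume "v \<in> orb (tau_lift w)"
    then obtain z where z: "z \<noteq> 0" "v = wact z (tau_lift w)" by (auto simp: mem_orb)
    then have "v = tau_lift (wact (inverse (cnj z)) w)" by (simp add: tau_lift_wact)
    moreover have "wact (inverse (cnj z)) w \<in> orb w"
      unfolding mem_orb using z by (intro exI[of _ "inverse (cnj z)"]) simp
    ultimately show "v \<in> tau_lift ` orb w" by (rule image_eqI)
  qed
  finally show ?thesis .
qed

lemma tau_hatD: "x \<in> hatD \<Longrightarrow> tau x \<in> hatD"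
  unfolding hatD_orb by (elim imageE) (simp add: tau_orb tau_lift_hatZ)

text \<open>\<open>tau_lift\<close> is conjugate-linear; the outer conjugation makes the
  differential complex-linear again.\<close>

lemma holo_hatZ_star:
  fixes f :: "'n::finite cpair \<Rightarrow> complex"
  assumes "holo_hatZ f" shows "holo_hatZ (\<lambda>w. cnj (f (tau_lift w)))"
  unfolding holo_hatZ_def
proof
  fix w :: "'n cpair" assume w: "w \<in> hatZ"
  have bl: "bounded_linear (tau_lift :: 'n cpair \<Rightarrow> 'n cpair)"
    unfolding linear_conv_bounded_linear[symmetric]
    by (intro linearI) (simp_all add: tau_lift_def vcnj_def vec_eq_iff)
  obtain U G where U: "tau_lift w \<in> U" "holo_open U G" and G: "\<forall>v\<in>U \<inter> hatZ. G v = f v"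
    using assms tau_lift_hatZ[OF w] unfolding holo_hatZ_def by blast
  have "holo_open (tau_lift -` U) (\<lambda>v. cnj (G (tau_lift v)))"
    unfolding holo_open_def
  proof (intro conjI ballI)
    show "open (tau_lift -` U)"
      using U bl by (intro open_vimage) (auto simp: holo_open_def intro: linear_continuous_on)
    fix v assume "v \<in> tau_lift -` U"
    then obtain L where L: "(G has_derivative L) (at (tau_lift v))" "\<forall>v. L (cscale \<i> v) = \<i> * L v"
      using U(2) unfolding holo_open_def by (metis vimageD)
    have lin: "linear L" using L(1) has_derivative_linear by auto
    have "((\<lambda>v. G (tau_lift v)) has_derivative (\<lambda>h. L (tau_lift h))) (at v)"
      using has_derivative_compose[OF bounded_linear_imp_has_derivative[OF bl] L(1)] by simp
    then have "((\<lambda>v. cnj (G (tau_lift v))) has_derivative (\<lambda>h. cnj (L (tau_lift h)))) (at v)"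
      by (rule bounded_linear.has_derivative[OF bounded_linear_cnj])
    moreover have "cnj (L (tau_lift (cscale \<i> h))) = \<i> * cnj (L (tau_lift h))" for h
    proof -
      have "tau_lift (cscale \<i> h) = - cscale \<i> (tau_lift h)"
        by (simp add: tau_lift_def cscale_def vec_eq_iff)
      then show ?thesis using L(2) linear_neg[OF lin] by (simp del: split_paired_All)
    qed
    ultimately show "\<exists>L. ((\<lambda>v. cnj (G (tau_lift v))) has_derivative L) (at v) \<and> (\<forall>v. L (cscale \<i> v) = \<i> * L v)"
      by (intro exI conjI allI)
  qed
  then show "\<exists>U G. w \<in> U \<and> holo_open U G \<and> (\<forall>v\<in>U \<inter> hatZ. G v = cnj (f (tau_lift v)))"
  proof (intro exI[of _ "tau_lift -` U"] exI[of _ "\<lambda>v. cnj (G (tau_lift v))"] conjI ballI)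
    fix v assume "v \<in> tau_lift -` U \<inter> hatZ"
    then have "tau_lift v \<in> U \<inter> hatZ" using tau_lift_hatZ[of v] by simp
    then show "cnj (G (tau_lift v)) = cnj (f (tau_lift v))" using G by simp
  qed (use U(1) in simp)
qed

text \<open>Diagonal points are fixed by \<open>tau\<close>, so inserting \<open>tau\<close> changes
  nothing on \<open>Dn\<close> while restoring holomorphy.\<close>

lemma is_ext_cnj:
  fixes a :: "'n::finite cvec set \<Rightarrow> complex"
  assumes "is_ext a F" shows "is_ext (\<lambda>x. cnj (a x)) (\<lambda>x. cnj (F (tau x)))"
  unfolding is_ext_def
proof
  show "holo_hatD (\<lambda>x. cnj (F (tau x)))"
    using holo_hatZ_star[of "\<lambda>w. F (orb w)"] assms by (simp add: holo_hatD_orb tau_orb is_ext_def)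
  show "\<forall>x\<in>Dn. cnj (a x) = cnj (F (tau (DeltaD x)))"
  proof
    fix x :: "'n cvec set" assume x: "x \<in> Dn"
    obtain r where "r \<in> x" using Dn_nonempty[OF x] by auto
    then have "tau (DeltaD x) = DeltaD x" using DnE(2)[OF x] by (simp add: tau_orb tau_lift_def)
    then show "cnj (a x) = cnj (F (tau (DeltaD x)))" using assms x by (simp add: is_ext_def)
  qed
qed

lemma AD_cnj: "a \<in> AD \<Longrightarrow> (\<lambda>x. cnj (a x)) \<in> AD"
  unfolding AD_iff by (auto intro: is_ext_cnj)

lemma hatA_cnj: "a \<in> AD \<Longrightarrow> x \<in> hatD \<Longrightarrow> hatA (\<lambda>x. cnj (a x)) x = cnj (hatA a (tau x))"
  by (rule hatA_x[OF is_ext_cnj[OF is_ext_hatA]])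

text \<open>By \<open>hatA_cnj\<close>, compatibility of \<open>delta x\<close> with conjugation
  means \<open>delta (tau x) = delta x\<close>, and \<open>delta\<close> is injective.\<close>

lemma delta_SpecStar_iff:
  fixes x :: "'n::finite cpair set"
  assumes x: "x \<in> hatD" shows "delta x \<in> SpecStar \<longleftrightarrow> tau x = x"
proof
  assume "delta x \<in> SpecStar"
  then have "delta (tau x) a = delta x a" for a
    using hatA_cnj[OF _ x, of a] AD_cnj[of a] by (auto simp: SpecStar_def delta_def restrict_def)
  then have "delta (tau x) = delta x" by auto
  then show "tau x = x" using inj_onD[OF delta_inj _ tau_hatD[OF x] x] by simp
next
  assume "tau x = x"
  then show "delta x \<in> SpecStar"
    using delta_Spec[OF x] hatA_cnj[OF _ x] AD_cnj by (auto simp: SpecStar_def delta_def)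
qed

theorem theorem4p9:
  shows "homeomorphic_map (hatD_top :: 'n::finite cpair set topology)
            (subtopology weak_star Spec) delta
       \<and> homeomorphic_map (subtopology (hatD_top :: 'n::finite cpair set topology) Dext)
            (subtopology weak_star SpecStar) delta"
proof
  show h: "homeomorphic_map (hatD_top :: 'n cpair set topology) (subtopology weak_star Spec) delta"
    by (rule delta_homeomorphic)
  have sub: "SpecStar \<subseteq> (Spec :: (('n cvec set \<Rightarrow> complex) \<Rightarrow> complex) set)" by (auto simp: SpecStar_def)
  \<comment> \<open>A homeomorphism restricts to subspaces once the image of \<open>Dext\<close> is
    identified.\<close>
  have "delta ` (topspace hatD_top \<inter> (Dext :: 'n cpair set set)) = topspace (subtopology weak_star Spec) \<inter> SpecStar"
  proof (intro set_eqI iffI)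
    fix \<phi> assume "\<phi> \<in> delta ` (topspace hatD_top \<inter> (Dext :: 'n cpair set set))"
    then obtain x where x: "x \<in> hatD" "tau x = x" "\<phi> = delta x" by (auto simp: Dext_def)
    then show "\<phi> \<in> topspace (subtopology weak_star Spec) \<inter> SpecStar"
      using delta_SpecStar_iff[OF x(1)] by (auto simp: topspace_weak_star SpecStar_def Spec_def)
  next
    fix \<phi> :: "('n cvec set \<Rightarrow> complex) \<Rightarrow> complex"
    assume \<phi>: "\<phi> \<in> topspace (subtopology weak_star Spec) \<inter> SpecStar"
    then obtain x where x: "x \<in> hatD" "\<phi> = delta x" using Spec_is_delta[of \<phi>] sub by auto
    then show "\<phi> \<in> delta ` (topspace hatD_top \<inter> Dext)"
      using delta_SpecStar_iff[OF x(1)] \<phi> by (auto simp: Dext_def)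
  qed
  then have "homeomorphic_map (subtopology hatD_top (Dext :: 'n cpair set set))
      (subtopology (subtopology weak_star Spec) SpecStar) delta"
    by (rule homeomorphic_map_subtopologies[OF h])
  moreover have "subtopology (subtopology weak_star Spec) SpecStar
      = subtopology weak_star (SpecStar :: (('n cvec set \<Rightarrow> complex) \<Rightarrow> complex) set)"
    using sub by (simp add: subtopology_subtopology Int_absorb1)
  ultimately show "homeomorphic_map (subtopology (hatD_top :: 'n cpair set topology) Dext)
      (subtopology weak_star SpecStar) delta" by simp
qed

end
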